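(* The real space $\ell_1$ has the AHSp-$\ell_\infty^n$ for every positive integer $n$. Indeed, for each positive integer $n$ there is a function $\gamma_n:(0,1)\to(0,1)$ such that $\ell_1$ has the AHSp-$\ell_\infty^n$ with the function $\gamma_n$ and, for every positive integer $m$, $\ell_1^m$ has the AHSp-$\ell_\infty^n$ with the same function $\gamma_n$.
   Context: All spaces are real. $\ell_1^m$ is $\mathbb{R}^m$ with the $\ell_1$-norm. $S_{Y^*}$ is the unit sphere of the dual of $Y$. $M_Y^n$ is the set of all $(y_i)_{i\le n}\in Y^n$ such that $\bigl\|\sum_{j=1}^k(-1)^{j+1}y_{i_j}\bigr\|\le 1$ for every odd $k\le n$ and all indices $1\le i_1<\dots<i_k\le n$. AHSp-$\ell_\infty^n$: a Banach space $Y$ has the approximate hyperplane sum property for $\ell_\infty^n$ with a function $\gamma_n:(0,1)\to(0,1)$ if for every $0<\varepsilon<1$ one has $0<\gamma_n(\varepsilon)<\varepsilon$ and: for every $(y_i)_{i\le n}\in M_Y^n$, if there exist a nonempty $A\subset\{1,\dots,n\}$ and $y^*\in S_{Y^*}$ with $y^*(y_i)>1-\gamma_n(\varepsilon)$ for each $i\in A$, then there exists $(z_i)_{i\le n}\in M_Y^n$ with $\|z_i-y_i\|<\varepsilon$ for every $i\le n$ and $\bigl\|\sum_{i\in A}z_i\bigr\|=|A|$. $Y$ has the AHSp-$\ell_\infty^n$ if it has it with some function $\gamma_n$. *)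

theory Defs
  imports "HOL-Analysis.Analysis" "HOL-Library.Function_Algebras"
begin

section \<open>Pointwise real vector space structure on functions\<close>

instantiation "fun" :: (type, real_vector) real_vector
begin

definition scaleR_fun :: "real \<Rightarrow> ('a \<Rightarrow> 'b) \<Rightarrow> 'a \<Rightarrow> 'b" where
  "scaleR_fun c f = (\<lambda>x. c *\<^sub>R f x)"

instance
  by standard (simp_all add: scaleR_fun_def fun_eq_iff algebra_simps)

end

section \<open>Real Banach spaces given by a carrier and a norm\<close>

text \<open>
  A space \<open>Y\<close> is a pair of a linear subspace \<open>V\<close> of a real vector space and a norm \<open>N\<close> on \<open>V\<close>.
  Carriers are used instead of types of class \<open>banach\<close> because the dimension of
  \<open>\<ell>\<^sub>1\<^sup>m\<close> has to be quantified inside a formula.  Values of \<open>N\<close> outside \<open>V\<close> are irrelevant.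
\<close>

definition norm_on :: "'a::real_vector set \<Rightarrow> ('a \<Rightarrow> real) \<Rightarrow> bool" where
  "norm_on V N \<longleftrightarrow> subspace V \<and>
     (\<forall>x\<in>V. 0 \<le> N x) \<and> (\<forall>x\<in>V. N x = 0 \<longrightarrow> x = 0) \<and>
     (\<forall>c. \<forall>x\<in>V. N (c *\<^sub>R x) = \<bar>c\<bar> * N x) \<and>
     (\<forall>x\<in>V. \<forall>y\<in>V. N (x + y) \<le> N x + N y)"

text \<open>The metric is cut off to \<open>0\<close> outside \<open>V\<close> because \<^locale>\<open>Metric_space\<close> asks for nonnegativity
  and symmetry on the whole type.\<close>

definition norm_dist_on :: "'a::real_vector set \<Rightarrow> ('a \<Rightarrow> real) \<Rightarrow> 'a \<Rightarrow> 'a \<Rightarrow> real" where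
  "norm_dist_on V N x y = (if x \<in> V \<and> y \<in> V then N (x - y) else 0)"

definition banach_on :: "'a::real_vector set \<Rightarrow> ('a \<Rightarrow> real) \<Rightarrow> bool" where
  "banach_on V N \<longleftrightarrow> norm_on V N \<and> Metric_space.mcomplete V (norm_dist_on V N)"

definition bounded_functional_on :: "'a::real_vector set \<Rightarrow> ('a \<Rightarrow> real) \<Rightarrow> ('a \<Rightarrow> real) \<Rightarrow> bool" where
  "bounded_functional_on V N f \<longleftrightarrow>
     (\<forall>x\<in>V. \<forall>y\<in>V. f (x + y) = f x + f y) \<and>
     (\<forall>c. \<forall>x\<in>V. f (c *\<^sub>R x) = c * f x) \<and>
     (\<exists>C. \<forall>x\<in>V. \<bar>f x\<bar> \<le> C * N x)"

definition dual_norm :: "'a::real_vector set \<Rightarrow> ('a \<Rightarrow> real) \<Rightarrow> ('a \<Rightarrow> real) \<Rightarrow> real" where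
  "dual_norm V N f = (SUP x\<in>{x \<in> V. N x \<le> 1}. \<bar>f x\<bar>)"

definition dual_sphere :: "'a::real_vector set \<Rightarrow> ('a \<Rightarrow> real) \<Rightarrow> ('a \<Rightarrow> real) set" where
  "dual_sphere V N = {f. bounded_functional_on V N f \<and> dual_norm V N f = 1}"

section \<open>The approximate hyperplane sum property\<close>

definition M_set :: "'a::real_vector set \<Rightarrow> ('a \<Rightarrow> real) \<Rightarrow> nat \<Rightarrow> (nat \<Rightarrow> 'a) set" where
  "M_set V N n = {y \<in> {1..n} \<rightarrow>\<^sub>E V.
     \<forall>k i. odd k \<and> k \<le> n \<and> strict_mono_on {1..k} i \<and> i ` {1..k} \<subseteq> {1..n} \<longrightarrow>
       N (\<Sum>j = 1..k. (-1) ^ (j + 1) *\<^sub>R y (i j)) \<le> 1}"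

text \<open>A function from \<open>(0,1)\<close> to \<open>(0,1)\<close> is a function on the reals whose values outside
  \<open>(0,1)\<close> are irrelevant; \<open>0 < \<gamma> \<epsilon> < \<epsilon>\<close> puts its values on \<open>(0,1)\<close> in \<open>(0,1)\<close>.\<close>

definition AHSp_linf_with ::
    "'a::real_vector set \<Rightarrow> ('a \<Rightarrow> real) \<Rightarrow> nat \<Rightarrow> (real \<Rightarrow> real) \<Rightarrow> bool" where
  "AHSp_linf_with V N n \<gamma> \<longleftrightarrow> banach_on V N \<and>
     (\<forall>\<epsilon>. 0 < \<epsilon> \<and> \<epsilon> < 1 \<longrightarrow>
       0 < \<gamma> \<epsilon> \<and> \<gamma> \<epsilon> < \<epsilon> \<and>
       (\<forall>y \<in> M_set V N n. \<forall>A f.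
          A \<noteq> {} \<and> A \<subseteq> {1..n} \<and> f \<in> dual_sphere V N \<and> (\<forall>i\<in>A. f (y i) > 1 - \<gamma> \<epsilon>) \<longrightarrow>
          (\<exists>z \<in> M_set V N n. (\<forall>i\<in>{1..n}. N (z i - y i) < \<epsilon>) \<and>
             N (\<Sum>i\<in>A. z i) = real (card A))))"

definition AHSp_linf :: "'a::real_vector set \<Rightarrow> ('a \<Rightarrow> real) \<Rightarrow> nat \<Rightarrow> bool" where
  "AHSp_linf V N n \<longleftrightarrow> (\<exists>\<gamma>. AHSp_linf_with V N n \<gamma>)"

section \<open>The spaces \<open>\<ell>\<^sub>1\<close> and \<open>\<ell>\<^sub>1\<^sup>m\<close>\<close>

definition ell1 :: "(nat \<Rightarrow> real) set" where
  "ell1 = {x. summable (\<lambda>i. \<bar>x i\<bar>)}"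

definition ell1_norm :: "(nat \<Rightarrow> real) \<Rightarrow> real" where
  "ell1_norm x = (\<Sum>i. \<bar>x i\<bar>)"

text \<open>\<open>\<real>\<^sup>m\<close> consists of the functions on \<open>{..<m}\<close>, extended by \<open>0\<close>.\<close>

definition ell1_fin :: "nat \<Rightarrow> (nat \<Rightarrow> real) set" where
  "ell1_fin m = {x. \<forall>i\<ge>m. x i = 0}"

definition ell1_fin_norm :: "nat \<Rightarrow> (nat \<Rightarrow> real) \<Rightarrow> real" where
  "ell1_fin_norm m x = (\<Sum>i<m. \<bar>x i\<bar>)"

section \<open>Both are Banach spaces\<close>

lemma Metric_space_norm_dist_on:
  assumes "norm_on V N"
  shows "Metric_space V (norm_dist_on V N)"
proof
  have sub: "subspace V" and nn: "\<And>x. x \<in> V \<Longrightarrow> 0 \<le> N x"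
    and z: "\<And>x. x \<in> V \<Longrightarrow> N x = 0 \<Longrightarrow> x = 0"
    and sc: "\<And>c x. x \<in> V \<Longrightarrow> N (c *\<^sub>R x) = \<bar>c\<bar> * N x"
    and tri: "\<And>x y. x \<in> V \<Longrightarrow> y \<in> V \<Longrightarrow> N (x + y) \<le> N x + N y"
    using assms by (auto simp: norm_on_def)
  have d: "x - y \<in> V" if "x \<in> V" "y \<in> V" for x y
    using sub that by (rule subspace_diff)
  fix x y w
  show "0 \<le> norm_dist_on V N x y"
    using nn d by (simp add: norm_dist_on_def)
  show "norm_dist_on V N x y = norm_dist_on V N y x"
    using sc[of "y - x" "-1"] d by (auto simp: norm_dist_on_def)
  have N0: "N 0 = 0" using sc[of 0 0] subspace_0[OF sub] by simp
  show "norm_dist_on V N x y = 0 \<longleftrightarrow> x = y" if "x \<in> V" "y \<in> V"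
    using z[of "x - y"] d that N0 by (auto simp: norm_dist_on_def)
  show "norm_dist_on V N x w \<le> norm_dist_on V N x y + norm_dist_on V N y w"
    if "x \<in> V" "y \<in> V" "w \<in> V"
    using tri[of "x - y" "y - w"] d that by (auto simp: norm_dist_on_def)
qed

lemma banach_onI:
  assumes n: "norm_on V N"
    and c: "\<And>s :: nat \<Rightarrow> _. (\<And>k. s k \<in> V) \<Longrightarrow>
        (\<And>e. e > 0 \<Longrightarrow> \<exists>K. \<forall>k\<ge>K. \<forall>l\<ge>K. N (s k - s l) < e) \<Longrightarrow>
        \<exists>x\<in>V. \<forall>e>0. \<exists>K. \<forall>k\<ge>K. N (s k - x) < e"
  shows "banach_on V N"
proof -
  interpret Metric_space V "norm_dist_on V N"
    using Metric_space_norm_dist_on[OF n] .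
  have "mcomplete"
    unfolding mcomplete_def
  proof (intro allI impI)
    fix s assume s: "MCauchy s"
    have sV: "s k \<in> V" for k using s by (auto simp: MCauchy_def)
    have "\<exists>K. \<forall>k\<ge>K. \<forall>l\<ge>K. N (s k - s l) < e" if "e > 0" for e
      using s that sV unfolding MCauchy_def norm_dist_on_def by auto
    with c[of s] sV obtain x where "x \<in> V" "\<forall>e>0. \<exists>K. \<forall>k\<ge>K. N (s k - x) < e"
      by blast
    then have "limitin mtopology s x sequentially"
      using sV by (simp add: limit_metric_sequentially norm_dist_on_def)
    then show "\<exists>x. limitin mtopology s x sequentially" ..
  qed
  with n show ?thesis by (simp add: banach_on_def)
qed

lemma norm_on_ell1: "norm_on ell1 ell1_norm"
proof -
  have add: "summable (\<lambda>i. \<bar>x i + y i\<bar>)" and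
    tri: "(\<Sum>i. \<bar>x i + y i\<bar>) \<le> (\<Sum>i. \<bar>x i\<bar>) + (\<Sum>i. \<bar>y i\<bar>)"
    if xy: "summable (\<lambda>i. \<bar>x i\<bar>)" "summable (\<lambda>i. \<bar>y i\<bar>)" for x y :: "nat \<Rightarrow> real"
  proof -
    have s: "summable (\<lambda>i. \<bar>x i\<bar> + \<bar>y i\<bar>)" using xy by (rule summable_add)
    show a: "summable (\<lambda>i. \<bar>x i + y i\<bar>)"
      by (rule summable_comparison_test'[OF s, of 0]) simp
    have "(\<Sum>i. \<bar>x i + y i\<bar>) \<le> (\<Sum>i. \<bar>x i\<bar> + \<bar>y i\<bar>)"
      using a s by (intro suminf_le) auto
    also have "\<dots> = (\<Sum>i. \<bar>x i\<bar>) + (\<Sum>i. \<bar>y i\<bar>)"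
      using xy by (simp add: suminf_add)
    finally show "(\<Sum>i. \<bar>x i + y i\<bar>) \<le> (\<Sum>i. \<bar>x i\<bar>) + (\<Sum>i. \<bar>y i\<bar>)" .
  qed
  have z: "x = 0" if "summable (\<lambda>i. \<bar>x i\<bar>)" "(\<Sum>i. \<bar>x i\<bar>) = 0" for x :: "nat \<Rightarrow> real"
    using that by (subst (asm) suminf_eq_zero_iff) (auto simp: fun_eq_iff)
  have scl: "summable (\<lambda>i. \<bar>c * x i\<bar>)" "(\<Sum>i. \<bar>c * x i\<bar>) = \<bar>c\<bar> * (\<Sum>i. \<bar>x i\<bar>)"
    if "summable (\<lambda>i. \<bar>x i\<bar>)" for c and x :: "nat \<Rightarrow> real"
    using summable_mult[OF that, of "\<bar>c\<bar>"] suminf_mult[OF that, of "\<bar>c\<bar>"]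
    by (simp_all add: abs_mult)
  have sub: "subspace ell1"
    using add scl by (simp add: subspace_def ell1_def scaleR_fun_def)
  have nn: "\<forall>x\<in>ell1. 0 \<le> ell1_norm x"
    by (simp add: ell1_def ell1_norm_def suminf_nonneg)
  show ?thesis
    unfolding norm_on_def
    using sub nn tri z scl by (simp add: ell1_def ell1_norm_def scaleR_fun_def)
qed

lemma abs_le_ell1_norm: "x \<in> ell1 \<Longrightarrow> \<bar>x i\<bar> \<le> ell1_norm x"
  using sum_le_suminf[of "\<lambda>i. \<bar>x i\<bar>" "{i}"] by (simp add: ell1_def ell1_norm_def)

lemma ell1_Cauchy_limit:
  fixes s :: "nat \<Rightarrow> nat \<Rightarrow> real"
  assumes sV: "\<And>k. s k \<in> ell1"
    and C: "\<And>e. e > 0 \<Longrightarrow> \<exists>K. \<forall>k\<ge>K. \<forall>l\<ge>K. ell1_norm (s k - s l) < e"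
  shows "\<exists>x\<in>ell1. (\<forall>i. (\<lambda>k. s k i) \<longlonglongrightarrow> x i) \<and>
    (\<forall>e>0. \<exists>K. \<forall>k\<ge>K. ell1_norm (s k - x) < e)"
proof -
  have sub: "subspace ell1" using norm_on_ell1 by (simp add: norm_on_def)
  have d: "s k - s l \<in> ell1" for k l using sub sV by (simp add: subspace_diff)
  have "Cauchy (\<lambda>k. s k i)" for i
  proof (rule metric_CauchyI)
    fix e :: real assume "e > 0"
    from C[OF this] obtain K where K: "\<forall>k\<ge>K. \<forall>l\<ge>K. ell1_norm (s k - s l) < e" by blast
    have "dist (s k i) (s l i) < e" if "k \<ge> K" "l \<ge> K" for k l
      using abs_le_ell1_norm[OF d, of k l i] K that by (fastforce simp: dist_real_def)
    then show "\<exists>K. \<forall>k\<ge>K. \<forall>l\<ge>K. dist (s k i) (s l i) < e" by blast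
  qed
  then have "\<exists>L. (\<lambda>k. s k i) \<longlonglongrightarrow> L" for i
    using Cauchy_convergent convergent_def by blast
  then obtain x where x: "\<And>i. (\<lambda>k. s k i) \<longlonglongrightarrow> x i" by metis
  have *: "\<exists>K. \<forall>k\<ge>K. s k - x \<in> ell1 \<and> ell1_norm (s k - x) < e" if "e > 0" for e
  proof -
    from C[of "e/2"] that obtain K
      where K: "\<forall>k\<ge>K. \<forall>l\<ge>K. ell1_norm (s k - s l) < e/2" by auto
    have "s k - x \<in> ell1 \<and> ell1_norm (s k - x) < e" if k: "k \<ge> K" for k
    proof -
      have b: "(\<Sum>i<m. \<bar>(s k - x) i\<bar>) \<le> e/2" for m
      proof (rule tendsto_upperbound)
        show "(\<lambda>l. \<Sum>i<m. \<bar>(s k - s l) i\<bar>) \<longlonglongrightarrow> (\<Sum>i<m. \<bar>(s k - x) i\<bar>)"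
          using x by (auto intro!: tendsto_intros)
        have "(\<Sum>i<m. \<bar>(s k - s l) i\<bar>) \<le> e/2" if "l \<ge> K" for l
          using sum_le_suminf[of "\<lambda>i. \<bar>(s k - s l) i\<bar>" "{..<m}"] d[of k l] K k that
          by (force simp: ell1_def ell1_norm_def)
        then show "\<forall>\<^sub>F l in sequentially. (\<Sum>i<m. \<bar>(s k - s l) i\<bar>) \<le> e/2"
          using eventually_sequentially by blast
      qed simp
      have sm: "summable (\<lambda>i. \<bar>(s k - x) i\<bar>)"
        by (rule summableI_nonneg_bounded[OF _ b]) simp
      have "(\<Sum>i. \<bar>(s k - x) i\<bar>) \<le> e/2"
        by (rule suminf_le_const[OF sm b])
      then show ?thesis using sm \<open>e > 0\<close> by (simp add: ell1_def ell1_norm_def)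
    qed
    then show ?thesis by blast
  qed
  from *[of 1] obtain K where "s K - x \<in> ell1" by auto
  then have "s K - (s K - x) \<in> ell1" using sub sV by (blast intro: subspace_diff)
  then have "x \<in> ell1" by simp
  moreover have "\<forall>e>0. \<exists>K. \<forall>k\<ge>K. ell1_norm (s k - x) < e" using * by blast
  ultimately show ?thesis using x by blast
qed

lemma banach_on_ell1: "banach_on ell1 ell1_norm"
proof (rule banach_onI[OF norm_on_ell1])
  fix s :: "nat \<Rightarrow> nat \<Rightarrow> real"
  assume sV: "\<And>k. s k \<in> ell1"
    and C: "\<And>e. e > 0 \<Longrightarrow> \<exists>K. \<forall>k\<ge>K. \<forall>l\<ge>K. ell1_norm (s k - s l) < e"
  show "\<exists>x\<in>ell1. \<forall>e>0. \<exists>K. \<forall>k\<ge>K. ell1_norm (s k - x) < e"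
    using ell1_Cauchy_limit[OF sV C] by blast
qed

lemma ell1_fin_in_ell1:
  assumes "x \<in> ell1_fin m"
  shows "x \<in> ell1" "ell1_norm x = ell1_fin_norm m x"
proof -
  have "(\<lambda>i. \<bar>x i\<bar>) sums (\<Sum>i<m. \<bar>x i\<bar>)"
    using assms by (intro sums_finite) (auto simp: ell1_fin_def)
  then show "x \<in> ell1" "ell1_norm x = ell1_fin_norm m x"
    by (auto simp: ell1_def ell1_norm_def ell1_fin_norm_def sums_iff)
qed

lemma subspace_ell1_fin: "subspace (ell1_fin m)"
  by (auto simp: subspace_def ell1_fin_def scaleR_fun_def)

lemma norm_on_ell1_fin: "norm_on (ell1_fin m) (ell1_fin_norm m)"
proof -
  have add: "x + y \<in> ell1_fin m" if "x \<in> ell1_fin m" "y \<in> ell1_fin m" for x y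
    using subspace_ell1_fin that by (rule subspace_add)
  have scl: "c *\<^sub>R x \<in> ell1_fin m" if "x \<in> ell1_fin m" for c x
    using subspace_ell1_fin that by (rule subspace_scale)
  show ?thesis
    using norm_on_ell1 subspace_ell1_fin add scl
    by (simp add: norm_on_def ell1_fin_in_ell1(1) flip: ell1_fin_in_ell1(2))
qed

lemma banach_on_ell1_fin: "banach_on (ell1_fin m) (ell1_fin_norm m)"
proof (rule banach_onI[OF norm_on_ell1_fin])
  fix s :: "nat \<Rightarrow> nat \<Rightarrow> real"
  assume sV: "\<And>k. s k \<in> ell1_fin m"
    and C: "\<And>e. e > 0 \<Longrightarrow> \<exists>K. \<forall>k\<ge>K. \<forall>l\<ge>K. ell1_fin_norm m (s k - s l) < e"
  have d: "s k - y \<in> ell1_fin m" if "y \<in> ell1_fin m" for k y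
    using subspace_ell1_fin sV that by (rule subspace_diff)
  have C': "\<exists>K. \<forall>k\<ge>K. \<forall>l\<ge>K. ell1_norm (s k - s l) < e" if "e > 0" for e
    using C[OF that] ell1_fin_in_ell1(2)[OF d[OF sV]] by simp
  obtain x where x: "\<forall>i. (\<lambda>k. s k i) \<longlonglongrightarrow> x i"
    "\<forall>e>0. \<exists>K. \<forall>k\<ge>K. ell1_norm (s k - x) < e"
    using ell1_Cauchy_limit[OF ell1_fin_in_ell1(1)[OF sV] C'] by blast
  have "x i = 0" if "i \<ge> m" for i
    using x(1)[rule_format, of i] sV that by (simp add: ell1_fin_def LIMSEQ_const_iff)
  then have xV: "x \<in> ell1_fin m" by (simp add: ell1_fin_def)
  then show "\<exists>x\<in>ell1_fin m. \<forall>e>0. \<exists>K. \<forall>k\<ge>K. ell1_fin_norm m (s k - x) < e"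
    using x(2) ell1_fin_in_ell1(2)[OF d[OF xV]] by auto
qed

end

theory Submission
  imports Defs
begin

text \<open>
  Write \<open>(y\<^sub>i)\<close> as a sequence of columns in \<open>\<real>\<^sup>n\<close>.  The finitely many alternating sums cut \<open>\<real>\<^sup>n\<close>
  into polyhedral cones, and the extreme rays of these cones form a finite set \<open>U\<close>, depending only
  on \<open>n\<close>, such that every column is a nonnegative combination of elements of \<open>U\<close> along which the
  absolute values of all alternating sums add up.  Hence the total weights \<open>t u\<close> of the rays
  determine all the norms involved, and they range over a compact polytope that does not depend on
  the space.  After a change of signs of the coordinates, the functional \<open>y*\<close> becomes the constant
  functional \<open>1\<close>, and the hypothesis says that \<open>t\<close> almost satisfies finitely many linear inequalities;
  by compactness there is a nearby \<open>t'\<close> that satisfies them exactly.  Redistributing the weights of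
  each ray over the coordinates in proportion \<open>t' u / t u\<close> gives \<open>(z\<^sub>i)\<close>.
\<close>

section \<open>Conic generators adapted to finitely many functionals\<close>

text \<open>The separate bound \<open>m\<close> makes representability closed under arbitrary sums; only the final
  instance \<open>m c = \<bar>c a\<bar>\<close> says that no functional in \<open>C\<close> sees cancellation.\<close>

definition conic_rep :: "'a::real_vector set \<Rightarrow> ('a \<Rightarrow> real) set \<Rightarrow> 'a \<Rightarrow> (('a \<Rightarrow> real) \<Rightarrow> real) \<Rightarrow> bool" where
  "conic_rep U C a m \<longleftrightarrow> (\<exists>t. (\<forall>u\<in>U. 0 \<le> t u) \<and> a = (\<Sum>u\<in>U. t u *\<^sub>R u) \<and>
     (\<forall>c\<in>C. (\<Sum>u\<in>U. t u * \<bar>c u\<bar>) \<le> m c))"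

lemma conic_rep_mono:
  assumes "conic_rep U C a m" "\<And>c. c \<in> C \<Longrightarrow> m c \<le> m' c"
  shows "conic_rep U C a m'"
proof -
  obtain t where "\<forall>u\<in>U. 0 \<le> t u" "a = (\<Sum>u\<in>U. t u *\<^sub>R u)" "\<forall>c\<in>C. (\<Sum>u\<in>U. t u * \<bar>c u\<bar>) \<le> m c"
    using assms(1) unfolding conic_rep_def by blast
  then show ?thesis
    unfolding conic_rep_def using assms(2) by (intro exI[of _ t]) force
qed

lemma conic_rep_0: "conic_rep U C 0 (\<lambda>_. 0)"
  unfolding conic_rep_def by (intro exI[of _ "\<lambda>_. 0"]) simp

lemma conic_rep_add:
  assumes "conic_rep U C a m" "conic_rep U C a' m'"
  shows "conic_rep U C (a + a') (\<lambda>c. m c + m' c)"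
proof -
  obtain t t' where "\<forall>u\<in>U. 0 \<le> t u" "a = (\<Sum>u\<in>U. t u *\<^sub>R u)" "\<forall>c\<in>C. (\<Sum>u\<in>U. t u * \<bar>c u\<bar>) \<le> m c"
    "\<forall>u\<in>U. 0 \<le> t' u" "a' = (\<Sum>u\<in>U. t' u *\<^sub>R u)" "\<forall>c\<in>C. (\<Sum>u\<in>U. t' u * \<bar>c u\<bar>) \<le> m' c"
    using assms unfolding conic_rep_def by blast
  then show ?thesis
    unfolding conic_rep_def
    by (intro exI[of _ "\<lambda>u. t u + t' u"])
      (auto simp: scaleR_add_left distrib_right sum.distrib intro: add_mono)
qed

lemma conic_rep_sum:
  assumes "\<And>k. k \<in> K \<Longrightarrow> conic_rep U C (a k) (m k)"
  shows "conic_rep U C (\<Sum>k\<in>K. a k) (\<lambda>c. \<Sum>k\<in>K. m k c)"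
  using assms
proof (induction K rule: infinite_finite_induct)
  case (insert k K)
  then show ?case using conic_rep_add[of U C "a k" "m k"] by simp
qed (simp_all add: conic_rep_0)

lemma conic_rep_generator:
  assumes "finite U" "u \<in> U" "0 \<le> k"
  shows "conic_rep U C (k *\<^sub>R u) (\<lambda>c. k * \<bar>c u\<bar>)"
proof -
  have "(\<Sum>v\<in>U. (if v = u then k else 0) *\<^sub>R v) = (\<Sum>v\<in>U. if v = u then k *\<^sub>R v else 0)"
    by (rule sum.cong) auto
  moreover have "(\<Sum>v\<in>U. (if v = u then k else 0) * \<bar>c v\<bar>) = (\<Sum>v\<in>U. if v = u then k * \<bar>c v\<bar> else 0)" for c
    by (rule sum.cong) auto
  ultimately show ?thesis
    unfolding conic_rep_def using assms
    by (intro exI[of _ "\<lambda>v. if v = u then k else 0"]) (auto simp: sum.delta)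
qed

lemma conic_rep_combination:
  assumes "finite U'" "U \<subseteq> U'" "\<And>u. u \<in> U \<Longrightarrow> 0 \<le> t u"
  shows "conic_rep U' C (\<Sum>u\<in>U. t u *\<^sub>R u) (\<lambda>c. \<Sum>u\<in>U. t u * \<bar>c u\<bar>)"
  using assms by (intro conic_rep_sum conic_rep_generator) auto

text \<open>Fourier--Motzkin step: the negative part of the combination is absorbed by the new generators
  \<open>c u *\<^sub>R v - c v *\<^sub>R u\<close> in the kernel of \<open>c\<close>, at the expense of scaling the positive part by
  \<open>1 - Q / P\<close>.\<close>

lemma conic_rep_eliminate:
  fixes c :: "'a::real_vector \<Rightarrow> real"
  assumes fin: "finite U" and lin: "linear c" "\<And>d. d \<in> C \<Longrightarrow> linear d"
    and rep: "conic_rep U C a (\<lambda>d. \<bar>d a\<bar>)"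
    and U': "finite U'" "U \<subseteq> U'"
    and w: "\<And>u v. u \<in> U \<Longrightarrow> v \<in> U \<Longrightarrow> c u > 0 \<Longrightarrow> c v < 0 \<Longrightarrow> c u *\<^sub>R v - c v *\<^sub>R u \<in> U'"
    and ca: "c a \<ge> 0"
  shows "conic_rep U' (insert c C) a (\<lambda>d. \<bar>d a\<bar>)"
proof -
  obtain t where t: "\<And>u. u \<in> U \<Longrightarrow> 0 \<le> t u" "a = (\<Sum>u\<in>U. t u *\<^sub>R u)"
    "\<And>d. d \<in> C \<Longrightarrow> (\<Sum>u\<in>U. t u * \<bar>d u\<bar>) \<le> \<bar>d a\<bar>"
    using rep unfolding conic_rep_def by blast
  define Ug Ul Uz where "Ug = {u\<in>U. c u > 0}" and "Ul = {u\<in>U. c u < 0}" and "Uz = {u\<in>U. c u = 0}"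
  have fins: "finite Ug" "finite Ul" "finite Uz" and subs: "Ug \<subseteq> U" "Ul \<subseteq> U" "Uz \<subseteq> U"
    using fin by (auto simp: Ug_def Ul_def Uz_def)
  have U_eq: "U = Ug \<union> Ul \<union> Uz" by (auto simp: Ug_def Ul_def Uz_def)
  have split: "(\<Sum>u\<in>U. g u) = (\<Sum>u\<in>Ug. g u) + (\<Sum>u\<in>Ul. g u) + (\<Sum>u\<in>Uz. g u)"
    for g :: "'a \<Rightarrow> 'b::ab_group_add"
  proof -
    have "sum g ((Ug \<union> Ul) \<union> Uz) = sum g (Ug \<union> Ul) + sum g Uz"
      using fins by (intro sum.union_disjoint) (auto simp: Ug_def Ul_def Uz_def)
    also have "sum g (Ug \<union> Ul) = sum g Ug + sum g Ul"
      using fins by (intro sum.union_disjoint) (auto simp: Ug_def Ul_def)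
    finally show ?thesis unfolding U_eq .
  qed
  define P Q where "P = (\<Sum>u\<in>Ug. t u * c u)" and "Q = (\<Sum>v\<in>Ul. t v * - c v)"
  have "c a = (\<Sum>u\<in>U. t u * c u)"
    using t(2) lin(1) by (simp add: linear_sum linear_scale)
  also have "\<dots> = P - Q"
    unfolding split P_def Q_def by (simp add: sum_negf Uz_def)
  finally have PQ: "c a = P - Q" .
  have tU: "t u \<ge> 0" if "u \<in> Ug \<or> u \<in> Ul \<or> u \<in> Uz" for u
    using that subs t(1) by blast
  have pos: "P \<ge> 0" "Q \<ge> 0"
    using tU unfolding P_def Q_def
    by (auto intro!: sum_nonneg mult_nonneg_nonneg mult_nonneg_nonpos simp: Ug_def Ul_def less_imp_le)
  \<comment> \<open>If \<open>P = 0\<close>, then \<open>c a = P - Q >= 0\<close> forces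
    \<open>Q = 0\<close>: the given combination already shows no cancellation under
    \<open>c\<close>. Otherwise division by \<open>P\<close> is possible.\<close>
  show ?thesis
  proof (cases "P = 0")
    case True
    then have "Q = 0" using PQ ca pos by simp
    have "(\<Sum>u\<in>U. t u * \<bar>c u\<bar>) = P + Q"
      unfolding split P_def Q_def
      by (simp add: Ug_def Ul_def Uz_def)
    then have "(\<Sum>u\<in>U. t u * \<bar>c u\<bar>) \<le> \<bar>c a\<bar>" using True \<open>Q = 0\<close> by simp
    moreover have "conic_rep U' (insert c C) a (\<lambda>d. \<Sum>u\<in>U. t u * \<bar>d u\<bar>)"
      using conic_rep_combination[OF U', of t] t(1,2) by blast
    ultimately show ?thesis using t(3) by (auto elim!: conic_rep_mono)
  next
    case False
    then have P: "P > 0" using pos by simp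
    let ?w = "\<lambda>u v. c u *\<^sub>R v - c v *\<^sub>R u"
    define K where "K = Ug \<times> Ul"
    \<comment> \<open>Because the numbers \<open>t u * c u\<close> sum to \<open>P\<close>, the
      weights \<open>t u * t v / P\<close> on the new generators reproduce each
      \<open>t v *\<^sub>R v\<close> exactly. They also yield the fraction \<open>Q / P\<close> of
      the positive part, hence the factor \<open>1 - Q/P\<close> left on the old positive
      generators.\<close>
    define mp where "mp d = (\<Sum>(u,v)\<in>K. (t u * t v / P) * \<bar>d (?w u v)\<bar>)" for d :: "'a \<Rightarrow> real"
    have r1: "conic_rep U' (insert c C) (\<Sum>(u,v)\<in>K. (t u * t v / P) *\<^sub>R ?w u v) mp"
      unfolding mp_def case_prod_unfold
      by (rule conic_rep_sum, rule conic_rep_generator)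
        (use U' w tU P in \<open>auto simp: K_def Ug_def Ul_def\<close>)
    have QP: "0 \<le> 1 - Q / P" using P PQ ca by simp
    have r2: "conic_rep U' (insert c C) (\<Sum>u\<in>Ug. ((1 - Q/P) * t u) *\<^sub>R u)
        (\<lambda>d. \<Sum>u\<in>Ug. ((1 - Q/P) * t u) * \<bar>d u\<bar>)"
      using U' subs QP tU by (intro conic_rep_combination mult_nonneg_nonneg) auto
    have r3: "conic_rep U' (insert c C) (\<Sum>u\<in>Uz. t u *\<^sub>R u) (\<lambda>d. \<Sum>u\<in>Uz. t u * \<bar>d u\<bar>)"
      using U' subs tU by (intro conic_rep_combination) auto
    have sumQ: "(\<Sum>v\<in>Ul. t v * c v) = - Q" by (simp add: Q_def sum_negf)
    have "(\<Sum>(u,v)\<in>K. (t u * t v / P) *\<^sub>R ?w u v)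
        = (\<Sum>u\<in>Ug. \<Sum>v\<in>Ul. (t u * c u / P) *\<^sub>R (t v *\<^sub>R v) - (t v * c v) *\<^sub>R ((t u / P) *\<^sub>R u))"
      unfolding K_def sum.cartesian_product[symmetric]
      by (intro sum.cong refl) (simp add: scaleR_diff_right mult_ac)
    also have "\<dots> = (\<Sum>u\<in>Ug. (t u * c u / P) *\<^sub>R (\<Sum>v\<in>Ul. t v *\<^sub>R v)) + (\<Sum>u\<in>Ug. (Q / P * t u) *\<^sub>R u)"
      by (simp add: sum_subtractf scaleR_sum_right[symmetric] scaleR_left.sum[symmetric] sumQ
          del: scaleR_scaleR) (simp add: sum.distrib scaleR_left.sum)
    also have "(\<Sum>u\<in>Ug. (t u * c u / P) *\<^sub>R (\<Sum>v\<in>Ul. t v *\<^sub>R v)) = (\<Sum>v\<in>Ul. t v *\<^sub>R v)"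
      using P by (simp add: scaleR_left.sum[symmetric] sum_divide_distrib[symmetric] P_def[symmetric])
    finally have e1: "(\<Sum>(u,v)\<in>K. (t u * t v / P) *\<^sub>R ?w u v)
        = (\<Sum>v\<in>Ul. t v *\<^sub>R v) + (\<Sum>u\<in>Ug. (Q / P * t u) *\<^sub>R u)" .
    have a_eq: "a = (\<Sum>(u,v)\<in>K. (t u * t v / P) *\<^sub>R ?w u v)
        + (\<Sum>u\<in>Ug. ((1 - Q/P) * t u) *\<^sub>R u) + (\<Sum>u\<in>Uz. t u *\<^sub>R u)"
      unfolding e1 t(2) split
      by (simp add: left_diff_distrib scaleR_diff_left sum_subtractf)
    have mC: "mp d + (\<Sum>u\<in>Ug. ((1 - Q/P) * t u) * \<bar>d u\<bar>) + (\<Sum>u\<in>Uz. t u * \<bar>d u\<bar>) \<le> \<bar>d a\<bar>"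
      if d: "d \<in> C" for d
    proof -
      \<comment> \<open>For \<open>c u > 0 > c v\<close> the triangle inequality bounds the value of
        \<open>d\<close> on a new generator by
        \<open>c u * \<bar>d v\<bar> - c v * \<bar>d u\<bar>\<close>. Summed with the weights, this
        is exactly the mass that \<open>d\<close> saw before on the replaced terms.\<close>
      have "mp d \<le> (\<Sum>(u,v)\<in>K. (t u * t v / P) * (c u * \<bar>d v\<bar> - c v * \<bar>d u\<bar>))"
        unfolding mp_def case_prod_unfold
      proof (intro sum_mono mult_left_mono)
        fix p assume p: "p \<in> K"
        have "d (?w (fst p) (snd p)) = c (fst p) * d (snd p) - c (snd p) * d (fst p)"
          using lin(2)[OF d] by (simp add: linear_diff linear_scale)
        then show "\<bar>d (?w (fst p) (snd p))\<bar> \<le> c (fst p) * \<bar>d (snd p)\<bar> - c (snd p) * \<bar>d (fst p)\<bar>"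
          using p abs_triangle_ineq4[of "c (fst p) * d (snd p)" "c (snd p) * d (fst p)"]
          by (auto simp: K_def Ug_def Ul_def abs_mult)
        show "0 \<le> t (fst p) * t (snd p) / P" using p tU P by (auto simp: K_def)
      qed
      also have "\<dots> = (\<Sum>u\<in>Ug. \<Sum>v\<in>Ul. (t u * c u / P) * (t v * \<bar>d v\<bar>) - (t v * c v) * (t u / P * \<bar>d u\<bar>))"
        unfolding K_def sum.cartesian_product[symmetric]
        by (intro sum.cong refl) (simp add: right_diff_distrib mult_ac)
      also have "\<dots> = (\<Sum>u\<in>Ug. (t u * c u / P) * (\<Sum>v\<in>Ul. t v * \<bar>d v\<bar>)) + (\<Sum>u\<in>Ug. (Q / P * t u) * \<bar>d u\<bar>)"
        unfolding sum.distrib[symmetric]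
      proof (intro sum.cong refl)
        fix u
        have "(\<Sum>v\<in>Ul. (t u * c u / P) * (t v * \<bar>d v\<bar>) - (t v * c v) * (t u / P * \<bar>d u\<bar>))
            = (t u * c u / P) * (\<Sum>v\<in>Ul. t v * \<bar>d v\<bar>) - (\<Sum>v\<in>Ul. t v * c v) * (t u / P * \<bar>d u\<bar>)"
          unfolding sum_subtractf sum_distrib_left sum_distrib_right ..
        then show "(\<Sum>v\<in>Ul. (t u * c u / P) * (t v * \<bar>d v\<bar>) - (t v * c v) * (t u / P * \<bar>d u\<bar>))
            = (t u * c u / P) * (\<Sum>v\<in>Ul. t v * \<bar>d v\<bar>) + (Q / P * t u) * \<bar>d u\<bar>"
          by (simp add: sumQ)
      qed
      also have "(\<Sum>u\<in>Ug. (t u * c u / P) * (\<Sum>v\<in>Ul. t v * \<bar>d v\<bar>)) = (\<Sum>v\<in>Ul. t v * \<bar>d v\<bar>)"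
        using P by (simp add: sum_distrib_right[symmetric] sum_divide_distrib[symmetric] P_def[symmetric])
      finally have "mp d \<le> (\<Sum>v\<in>Ul. t v * \<bar>d v\<bar>) + (\<Sum>u\<in>Ug. (Q / P * t u) * \<bar>d u\<bar>)" .
      then show ?thesis
        using t(3)[OF d] unfolding split by (simp add: left_diff_distrib sum_subtractf)
    qed
    \<comment> \<open>The new generators and \<open>Uz\<close> lie in the kernel of
      \<open>c\<close>. Only the shrunken positive part remains, with mass
      \<open>(1 - Q/P) * P = P - Q = c a\<close>.\<close>
    have "mp c = 0"
      unfolding mp_def using lin(1) by (intro sum.neutral) (auto simp: linear_diff linear_scale)
    moreover have "(\<Sum>u\<in>Ug. ((1 - Q/P) * t u) * \<bar>c u\<bar>) = (1 - Q/P) * P"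
      unfolding P_def sum_distrib_left by (intro sum.cong) (auto simp: Ug_def)
    moreover have "(\<Sum>u\<in>Uz. t u * \<bar>c u\<bar>) = 0" by (simp add: Uz_def)
    ultimately have mc: "mp c + (\<Sum>u\<in>Ug. ((1 - Q/P) * t u) * \<bar>c u\<bar>) + (\<Sum>u\<in>Uz. t u * \<bar>c u\<bar>) \<le> \<bar>c a\<bar>"
      using P PQ by (simp add: left_diff_distrib)
    show ?thesis
      using conic_rep_add[OF conic_rep_add[OF r1 r2] r3] unfolding a_eq[symmetric]
      by (rule conic_rep_mono) (use mC mc in auto)
  qed
qed

text \<open>Induction on \<open>C\<close>, one elimination per functional, starting from generators
  \<open>U0\<close> that need not respect any functional. The set obtained depends on
  \<open>C\<close> and \<open>U0\<close> only, not on the vector \<open>a\<close>.\<close>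

lemma finite_conic_generators:
  fixes C :: "('a::real_vector \<Rightarrow> real) set"
  assumes "finite C" "\<And>c. c \<in> C \<Longrightarrow> linear c"
    and U0: "finite U0" "\<And>a. a \<in> V \<Longrightarrow> conic_rep U0 {} a (\<lambda>_. 0)"
  shows "\<exists>U. finite U \<and> (\<forall>a\<in>V. conic_rep U C a (\<lambda>c. \<bar>c a\<bar>))"
  using assms(1,2)
proof (induction C rule: finite_induct)
  case empty
  show ?case using U0 by (auto simp: conic_rep_def)
next
  case (insert c C)
  then obtain U where U: "finite U" "\<And>a. a \<in> V \<Longrightarrow> conic_rep U C a (\<lambda>c. \<bar>c a\<bar>)"
    by blast
  define U' where "U' = U \<union> (\<lambda>(u,v). c u *\<^sub>R v - c v *\<^sub>R u) ` (U \<times> U)"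
  have U': "finite U'" "U \<subseteq> U'" using U(1) by (auto simp: U'_def)
  have w: "c u *\<^sub>R v - c v *\<^sub>R u \<in> U'" if "u \<in> U" "v \<in> U" for u v
    using that by (auto simp: U'_def)
  have "conic_rep U' (insert c C) a (\<lambda>c. \<bar>c a\<bar>)" if a: "a \<in> V" for a
  proof (cases "c a \<ge> 0")
    case True
    then show ?thesis
      using insert.prems by (intro conic_rep_eliminate[OF U(1) _ _ U(2)[OF a] U' w]) auto
  next
    \<comment> \<open>Elimination is run with \<open>-c\<close>. Exchanging \<open>u\<close> and
      \<open>v\<close> turns its new generators into those of \<open>c\<close>, so the same
      \<open>U'\<close> serves both signs; \<open>conic_rep\<close> sees only absolute values of
      \<open>c\<close>.\<close>
    case False
    let ?c = "\<lambda>x. - c x"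
    have w': "?c u *\<^sub>R v - ?c v *\<^sub>R u \<in> U'" if "u \<in> U" "v \<in> U" for u v
      using w[OF that(2,1)] by (simp add: algebra_simps)
    have "linear ?c" using insert.prems by (simp add: linear_compose_neg)
    then have "conic_rep U' (insert ?c C) a (\<lambda>c. \<bar>c a\<bar>)"
      using insert.prems False by (intro conic_rep_eliminate[OF U(1) _ _ U(2)[OF a] U' w']) auto
    then show ?thesis by (simp add: conic_rep_def)
  qed
  with U'(1) show ?case by blast
qed

section \<open>Stability of finite systems of linear inequalities\<close>

text \<open>Tychonoff's theorem for a product of intervals.\<close>

lemma compact_box:
  fixes B :: "'i \<Rightarrow> real"
  shows "compact {t. \<forall>u. 0 \<le> t u \<and> t u \<le> B u}"
proof -
  have "{t. \<forall>u. 0 \<le> t u \<and> t u \<le> B u} = (\<Pi>\<^sub>E u\<in>UNIV. {0..B u})"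
    by (auto simp: PiE_def Pi_def)
  moreover have "compactin (product_topology (\<lambda>_. euclidean) UNIV) (\<Pi>\<^sub>E u\<in>UNIV. {0..B u})"
    unfolding compactin_PiE by (simp add: compactin_euclidean_iff)
  ultimately show ?thesis
    by (metis compactin_euclidean_iff euclidean_product_topology)
qed

text \<open>The points of \<open>K\<close> far from \<open>{s\<in>K. g s \<le> 0}\<close> form a
  compact set \<open>D\<close>. There \<open>g\<close> is positive, since a point with
  \<open>g t \<le> 0\<close> is close to itself, so the minimum of \<open>g\<close> on
  \<open>D\<close> is the required \<open>d\<close>.\<close>

lemma compact_near_zero_set:
  fixes g :: "'a::topological_space \<Rightarrow> real" and dst :: "'a \<Rightarrow> 'a \<Rightarrow> real"
  assumes K: "compact K" and g: "continuous_on K g"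
    and dst: "\<And>s. continuous_on UNIV (\<lambda>t. dst s t)"
    and refl: "\<And>t. dst t t = 0" and e: "0 < e"
  shows "\<exists>d>0. \<forall>t\<in>K. g t < d \<longrightarrow> (\<exists>s\<in>K. g s \<le> 0 \<and> dst s t < e)"
proof -
  define D where "D = K \<inter> (\<Inter>s\<in>{s\<in>K. g s \<le> 0}. {t. e \<le> dst s t})"
  have "closed {t. e \<le> dst s t}" for s
    by (rule closed_Collect_le) (use dst in auto)
  then have D: "compact D"
    unfolding D_def using K by (intro compact_Int_closed closed_INT) auto
  have pos: "g t > 0" if "t \<in> D" for t
    using that refl[of t] e by (force simp: D_def not_le[symmetric])
  show ?thesis
  proof (cases "D = {}")
    case True
    then show ?thesis
      by (intro exI[of _ 1]) (force simp: D_def not_le[symmetric])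
  next
    case False
    have "continuous_on D g" using g by (rule continuous_on_subset) (auto simp: D_def)
    from continuous_attains_inf[OF D False this] obtain t0
      where t0: "t0 \<in> D" "\<And>t. t \<in> D \<Longrightarrow> g t0 \<le> g t" by blast
    show ?thesis
    proof (intro exI[of _ "g t0"] conjI ballI impI)
      show "g t0 > 0" using pos t0 by blast
      fix t assume "t \<in> K" "g t < g t0"
      then have "t \<notin> D" using t0(2) by force
      then show "\<exists>s\<in>K. g s \<le> 0 \<and> dst s t < e"
        using \<open>t \<in> K\<close> by (force simp: D_def not_le)
    qed
  qed
qed

section \<open>Alternating sums\<close>

definition alt_sum :: "nat \<Rightarrow> (nat \<Rightarrow> nat) \<Rightarrow> (nat \<Rightarrow> real) \<Rightarrow> real" where
  "alt_sum k i a = (\<Sum>j = 1..k. (-1) ^ (j + 1) * a (i j))"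

definition alt_functionals :: "nat \<Rightarrow> ((nat \<Rightarrow> real) \<Rightarrow> real) set" where
  "alt_functionals n = {alt_sum k i |k i.
     odd k \<and> k \<le> n \<and> strict_mono_on {1..k} i \<and> i ` {1..k} \<subseteq> {1..n}}"

lemma sum_fun_apply: "(\<Sum>k\<in>K. f k) x = (\<Sum>k\<in>K. f k x)"
  by (induction K rule: infinite_finite_induct) auto

lemma linear_alt_functionals:
  assumes "c \<in> alt_functionals n"
  shows "linear c"
proof -
  have "linear (alt_sum k i)" for k i
    by (rule linearI)
      (simp_all only: alt_sum_def plus_fun_apply scaleR_fun_def distrib_left sum.distrib
          sum_distrib_left mult_ac real_scaleR_def)
  then show ?thesis using assms by (auto simp: alt_functionals_def)
qed

text \<open>An index function matters only on \<open>{1..k}\<close>, so it may be replaced by its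
  restriction, and there are finitely many of these.\<close>

lemma finite_alt_functionals: "finite (alt_functionals n)"
proof (rule finite_subset)
  show "alt_functionals n \<subseteq> (\<lambda>(k, i). alt_sum k i) ` (SIGMA k:{..n}. {1..k} \<rightarrow>\<^sub>E {1..n})"
  proof
    fix c assume "c \<in> alt_functionals n"
    then obtain k i where c: "c = alt_sum k i" "k \<le> n" "i ` {1..k} \<subseteq> {1..n}"
      by (auto simp: alt_functionals_def)
    have "c = alt_sum k (restrict i {1..k})"
      using c(1) by (simp add: alt_sum_def fun_eq_iff)
    then show "c \<in> (\<lambda>(k, i). alt_sum k i) ` (SIGMA k:{..n}. {1..k} \<rightarrow>\<^sub>E {1..n})"
      using c(2,3) by (intro image_eqI[of _ _ "(k, restrict i {1..k})"]) auto
  qed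
qed (auto intro!: finite_PiE)

lemma alt_functionals_cong:
  assumes "c \<in> alt_functionals n" "\<And>i. i \<in> {1..n} \<Longrightarrow> a i = b i"
  shows "c a = c b"
proof -
  obtain k i where c: "c = alt_sum k i" "i ` {1..k} \<subseteq> {1..n}"
    using assms(1) by (auto simp: alt_functionals_def)
  show ?thesis
    unfolding c(1) alt_sum_def using c(2) assms(2)
    by (intro sum.cong refl) (simp add: image_subset_iff)
qed

text \<open>The case \<open>k = 1\<close>. Through it every bound on the alternating sums also
  controls the single vectors, the distances and the size of the weights.\<close>

lemma coordinate_in_alt_functionals:
  assumes "i \<in> {1..n}"
  shows "(\<lambda>a. a i) \<in> alt_functionals n"
proof -
  have "(\<lambda>a. a i) = alt_sum 1 (\<lambda>_. i)" by (simp add: alt_sum_def fun_eq_iff)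
  then show ?thesis
    using assms unfolding alt_functionals_def
    by (intro CollectI exI[of _ 1] exI[of _ "\<lambda>_. i"]) (auto simp: strict_mono_on_def)
qed

text \<open>Passage from rows to columns: the coordinate \<open>j\<close> of an alternating sum of
  the tuple is the alternating functional applied to the column
  \<open>\<lambda>i. y i j\<close>.\<close>

lemma M_set_iff:
  fixes y :: "nat \<Rightarrow> nat \<Rightarrow> real"
  shows "y \<in> M_set V N n \<longleftrightarrow> y \<in> {1..n} \<rightarrow>\<^sub>E V \<and>
    (\<forall>c\<in>alt_functionals n. N (\<lambda>j. c (\<lambda>i. y i j)) \<le> 1)"
proof -
  have "(\<Sum>j = 1..k. (-1) ^ (j + 1) *\<^sub>R y (i j)) = (\<lambda>l. alt_sum k i (\<lambda>i. y i l))" for k i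
    by (simp add: fun_eq_iff sum_fun_apply scaleR_fun_def alt_sum_def)
  then show ?thesis
    unfolding M_set_def alt_functionals_def by (simp only: mem_Collect_eq) blast
qed

lemma M_set_coordinate:
  fixes y :: "nat \<Rightarrow> nat \<Rightarrow> real"
  assumes "y \<in> M_set V N n" "i \<in> {1..n}"
  shows "y i \<in> V" "N (y i) \<le> 1"
proof -
  have y: "y \<in> {1..n} \<rightarrow>\<^sub>E V" "\<forall>c\<in>alt_functionals n. N (\<lambda>j. c (\<lambda>i. y i j)) \<le> 1"
    using assms(1) unfolding M_set_iff by (rule conjunct1, rule conjunct2)
  show "y i \<in> V" using y(1) assms(2) by (rule PiE_mem)
  show "N (y i) \<le> 1" using bspec[OF y(2) coordinate_in_alt_functionals[OF assms(2)]] .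
qed

section \<open>Subspaces of \<open>\<ell>\<^sub>1\<close> spanned by coordinates\<close>

text \<open>A common form of both kinds of spaces, \<open>J = UNIV\<close> for \<open>ell1\<close>
  and \<open>J = {..<m}\<close> for \<open>ell1_fin m\<close>, so that the main argument runs
  once.\<close>

definition coord_space :: "nat set \<Rightarrow> (nat \<Rightarrow> real) set" where
  "coord_space J = {x \<in> ell1. \<forall>j. j \<notin> J \<longrightarrow> x j = 0}"

lemma ell1_eq_coord_space: "ell1 = coord_space UNIV"
  by (simp add: coord_space_def)

lemma ell1_fin_eq_coord_space: "ell1_fin m = coord_space {..<m}"
proof -
  have "x \<in> ell1" if "\<forall>j\<ge>m. x j = 0" for x
    using that ell1_fin_in_ell1(1)[of x m] by (simp add: ell1_fin_def)
  then show ?thesis by (auto simp: coord_space_def ell1_fin_def not_less)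
qed

lemma coord_space_dominated:
  assumes "x \<in> coord_space J" "\<And>j. \<bar>w j\<bar> \<le> \<bar>x j\<bar>"
  shows "w \<in> coord_space J"
proof -
  have "summable (\<lambda>j. \<bar>w j\<bar>)"
    by (rule summable_comparison_test'[of "\<lambda>j. \<bar>x j\<bar>" 0])
      (use assms in \<open>auto simp: coord_space_def ell1_def\<close>)
  moreover have "w j = 0" if "j \<notin> J" for j
    using assms(1) assms(2)[of j] that by (simp add: coord_space_def)
  ultimately show ?thesis by (simp add: coord_space_def ell1_def)
qed

lemma ell1_tail_tendsto_0:
  assumes "x \<in> ell1"
  shows "(\<lambda>k. ell1_norm (\<lambda>j. if j < k then 0 else x j)) \<longlonglongrightarrow> 0"
proof -
  have s: "summable (\<lambda>j. \<bar>x j\<bar>)" using assms by (simp add: ell1_def)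
  have "ell1_norm (\<lambda>j. if j < k then 0 else x j) = (\<Sum>j. \<bar>x (j + k)\<bar>)" for k
  proof -
    have "summable (\<lambda>j. \<bar>if j < k then 0 else x j\<bar>)"
      by (rule summable_comparison_test'[OF s, of 0]) auto
    from suminf_split_initial_segment[OF this, of k] show ?thesis
      by (simp add: ell1_norm_def)
  qed
  moreover have "(\<lambda>k. \<Sum>j. \<bar>x (j + k)\<bar>) \<longlonglongrightarrow> 0"
    using suminf_exist_split2[OF s] .
  ultimately show ?thesis by simp
qed

section \<open>Replacing a norm-one functional by a sequence of signs\<close>

text \<open>Take \<open>s j\<close> to be the sign of \<open>f\<close> at the unit vector
  \<open>e j\<close>. Then \<open>f\<close> is nonnegative on the finite truncations of
  \<open>x\<close>; these converge to \<open>x\<close> in norm, and \<open>f\<close> is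
  bounded.\<close>

lemma functional_signs:
  assumes V: "V = coord_space J" and N: "\<And>x. x \<in> V \<Longrightarrow> N x = ell1_norm x"
    and f: "bounded_functional_on V N f" and "subspace V"
  shows "\<exists>s :: nat \<Rightarrow> real. (\<forall>j. \<bar>s j\<bar> = 1) \<and> (\<forall>x\<in>V. (\<forall>j. 0 \<le> s j * x j) \<longrightarrow> 0 \<le> f x)"
proof -
  define e :: "nat \<Rightarrow> nat \<Rightarrow> real" where "e j = (\<lambda>i. if i = j then 1 else 0)" for j
  \<comment> \<open>If \<open>e j\<close> lies outside \<open>V\<close>, the value
    \<open>f (e j)\<close> is arbitrary. This does no harm, because every \<open>x\<close> in
    \<open>V\<close> then has \<open>x j = 0\<close>.\<close>
  define s where "s j = (if 0 \<le> f (e j) then 1 else - 1 :: real)" for j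
  have add: "f (x + y) = f x + f y" if "x \<in> V" "y \<in> V" for x y
    using f that by (simp add: bounded_functional_on_def)
  have scl: "f (r *\<^sub>R x) = r * f x" if "x \<in> V" for r x
    using f that by (simp add: bounded_functional_on_def)
  obtain C where C: "\<And>x. x \<in> V \<Longrightarrow> \<bar>f x\<bar> \<le> C * N x"
    using f unfolding bounded_functional_on_def by blast
  have f0: "f 0 = 0" using scl[of 0 0] \<open>subspace V\<close> by (simp add: subspace_0)
  have "0 \<le> f x" if x: "x \<in> V" and nonneg: "\<And>j. 0 \<le> s j * x j" for x
  proof -
    have sub: "w \<in> V" if "\<And>j. \<bar>w j\<bar> \<le> \<bar>x j\<bar>" for w
      using coord_space_dominated x that unfolding V by blast
    have summand: "0 \<le> f (x j *\<^sub>R e j)" for j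
    proof (cases "x j = 0")
      case True
      then show ?thesis by (simp add: f0)
    next
      case False
      have "x j *\<^sub>R e j \<in> V" by (rule sub) (simp add: scaleR_fun_def e_def)
      then have "(1 / x j) *\<^sub>R (x j *\<^sub>R e j) \<in> V"
        using \<open>subspace V\<close> by (rule subspace_scale[rotated])
      then have "e j \<in> V" using False by simp
      moreover have "0 \<le> x j * f (e j)"
        using nonneg[of j] by (auto simp: s_def zero_le_mult_iff split: if_splits)
      ultimately show ?thesis by (simp add: scl)
    qed
    define h where "h k = (\<lambda>j. if j < k then x j else 0)" for k
    have hV: "h k \<in> V" for k by (rule sub) (simp add: h_def)
    have "0 \<le> f (h k)" for k
    proof (induction k)
      case 0
      have "h 0 = 0" by (simp add: h_def fun_eq_iff)
      then show ?case by (simp only: f0 order_refl)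
    next
      case (Suc k)
      have "x k *\<^sub>R e k \<in> V" by (rule sub) (simp add: scaleR_fun_def e_def)
      moreover have "h (Suc k) = h k + x k *\<^sub>R e k"
        by (auto simp: h_def e_def scaleR_fun_def fun_eq_iff less_Suc_eq)
      ultimately have "f (h (Suc k)) = f (h k) + f (x k *\<^sub>R e k)" using add hV by metis
      then show ?case using Suc summand[of k] by linarith
    qed
    moreover have "(\<lambda>k. f (h k)) \<longlonglongrightarrow> f x"
    proof (rule Lim_null[THEN iffD2], rule Lim_null_comparison)
      have "\<bar>f (h k) - f x\<bar> \<le> C * ell1_norm (\<lambda>j. if j < k then 0 else x j)" for k
      proof -
        let ?r = "\<lambda>j. if j < k then 0 else x j"
        have r: "?r \<in> V" by (rule sub) simp
        have "x = h k + ?r" by (auto simp: h_def fun_eq_iff)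
        then have "f x = f (h k) + f ?r" using add[OF hV r] by metis
        then show ?thesis using C[OF r] N[OF r] by simp
      qed
      then show "\<forall>\<^sub>F k in sequentially. norm (f (h k) - f x) \<le> C * ell1_norm (\<lambda>j. if j < k then 0 else x j)"
        by simp
      show "(\<lambda>k. C * ell1_norm (\<lambda>j. if j < k then 0 else x j)) \<longlonglongrightarrow> 0"
        using x ell1_tail_tendsto_0[of x] unfolding V
        by (auto simp: coord_space_def intro: tendsto_mult_right_zero)
    qed
    ultimately show ?thesis by (meson LIMSEQ_le_const)
  qed
  moreover have "\<bar>s j\<bar> = 1" for j by (simp add: s_def)
  ultimately show ?thesis by blast
qed

lemma dual_sphere_le_norm:
  assumes "norm_on V N" "f \<in> dual_sphere V N" "x \<in> V"
  shows "f x \<le> N x"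
proof -
  have f: "bounded_functional_on V N f" "dual_norm V N f = 1"
    using assms(2) by (auto simp: dual_sphere_def)
  obtain C where C: "\<And>x. x \<in> V \<Longrightarrow> \<bar>f x\<bar> \<le> C * N x"
    using f(1) unfolding bounded_functional_on_def by blast
  have n0: "0 \<le> N z" if "z \<in> V" for z using assms(1) that by (simp add: norm_on_def)
  show ?thesis
  proof (cases "N x = 0")
    case True
    then show ?thesis using C[OF assms(3)] by simp
  next
    case False
    then have pos: "N x > 0" using n0[OF assms(3)] by simp
    let ?z = "(1 / N x) *\<^sub>R x"
    have z: "?z \<in> V" "N ?z = 1"
      using assms(1,3) pos by (auto simp: norm_on_def subspace_scale)
    \<comment> \<open>A real supremum bounds the members of its set only if the set is bounded
      above. The constant is \<open>\<bar>C\<bar>\<close> because \<open>C\<close> might be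
      negative.\<close>
    have "bdd_above ((\<lambda>x. \<bar>f x\<bar>) ` {x \<in> V. N x \<le> 1})"
    proof (intro bdd_aboveI2)
      fix w assume w: "w \<in> {x \<in> V. N x \<le> 1}"
      have "\<bar>f w\<bar> \<le> C * N w" using C w by simp
      also have "\<dots> \<le> \<bar>C\<bar> * N w" using w n0 by (intro mult_right_mono) auto
      also have "\<dots> \<le> \<bar>C\<bar>" using w by (intro mult_left_le) auto
      finally show "\<bar>f w\<bar> \<le> \<bar>C\<bar>" .
    qed
    then have "\<bar>f ?z\<bar> \<le> 1"
      using z f(2) unfolding dual_norm_def by (metis (mono_tags, lifting) cSUP_upper mem_Collect_eq order_refl)
    moreover have "f ?z = f x / N x"
      using f(1) assms(3) by (simp add: bounded_functional_on_def)
    ultimately show ?thesis using pos by (simp add: field_simps abs_le_iff)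
  qed
qed

text \<open>A functional almost norming \<open>x\<close> may be replaced by a \<open>\<plusminus>1\<close>-valued one: setting the coordinates
  of \<open>x\<close> with the wrong sign to \<open>0\<close> does not decrease \<open>f x\<close>, so they carry little mass.\<close>

lemma dual_sphere_signs:
  assumes V: "V = coord_space J" and N: "\<And>x. x \<in> V \<Longrightarrow> N x = ell1_norm x"
    and nrm: "norm_on V N" and f: "f \<in> dual_sphere V N"
  shows "\<exists>s :: nat \<Rightarrow> real. (\<forall>j. \<bar>s j\<bar> = 1) \<and>
    (\<forall>x\<in>V. N x \<le> 1 \<longrightarrow> 2 * f x - 1 \<le> (\<Sum>j. s j * x j))"
proof -
  have fb: "bounded_functional_on V N f" using f by (simp add: dual_sphere_def)
  have subV: "subspace V" using nrm by (simp add: norm_on_def)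
  obtain s :: "nat \<Rightarrow> real" where s: "\<And>j. \<bar>s j\<bar> = 1"
    "\<And>x. x \<in> V \<Longrightarrow> (\<And>j. 0 \<le> s j * x j) \<Longrightarrow> 0 \<le> f x"
    using functional_signs[OF V N fb subV] by blast
  have "2 * f x - 1 \<le> (\<Sum>j. s j * x j)" if x: "x \<in> V" "N x \<le> 1" for x
  proof -
    \<comment> \<open>\<open>v - x\<close> consists of the wrongly signed coordinates of
      \<open>x\<close> with reversed sign, so \<open>f (v - x)\<close> is nonnegative and
      \<open>f x \<le> f v \<le> N v\<close>.\<close>
    define v where "v j = (if 0 \<le> s j * x j then x j else 0)" for j
    have v: "v \<in> V"
      using x(1) unfolding V by (rule coord_space_dominated) (simp add: v_def)
    have w: "v - x \<in> V" using subV v x(1) by (rule subspace_diff)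
    have "0 \<le> f (v - x)"
      by (rule s(2)[OF w]) (simp add: v_def)
    moreover have "f v = f x + f (v - x)"
      using fb x(1) w unfolding bounded_functional_on_def by (metis add_diff_cancel_left' add.commute diff_add_cancel)
    ultimately have "f x \<le> N v" using dual_sphere_le_norm[OF nrm f v] by simp
    also have "\<dots> = (\<Sum>j. \<bar>v j\<bar>)" using N[OF v] by (simp add: ell1_norm_def)
    finally have fv: "f x \<le> (\<Sum>j. \<bar>v j\<bar>)" .
    have sx: "summable (\<lambda>j. \<bar>x j\<bar>)" and sv: "summable (\<lambda>j. \<bar>v j\<bar>)"
      using x(1) v unfolding V by (auto simp: coord_space_def ell1_def)
    \<comment> \<open>This identity is the source of the factor 2: the signed sum equals
      \<open>2 * N v - N x\<close>, which is at least \<open>2 * f x - 1\<close>.\<close>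
    have "s j * x j = 2 * \<bar>v j\<bar> - \<bar>x j\<bar>" for j
      using s(1)[of j] by (auto simp: v_def abs_if zero_le_mult_iff split: if_splits)
    then have "(\<Sum>j. s j * x j) = 2 * (\<Sum>j. \<bar>v j\<bar>) - (\<Sum>j. \<bar>x j\<bar>)"
      using sx sv by (simp add: suminf_diff[symmetric] suminf_mult summable_mult)
    then show ?thesis
      using fv x(2) N[OF x(1)] by (simp add: ell1_norm_def)
  qed
  with s(1) show ?thesis by blast
qed

section \<open>A finite model of the tuples in \<open>\<ell>\<^sub>1\<close>\<close>

text \<open>A tuple \<open>(y\<^sub>i)\<close> in \<open>\<ell>\<^sub>1\<close> is read columnwise, as a sequence of vectors \<open>(y\<^sub>i j)\<^sub>i\<close>
  in \<open>\<real>\<^sup>n\<close>.  The absolute values of all alternating sums are additive along the decomposition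
  of a column into the generators.\<close>

definition alt_generators :: "nat \<Rightarrow> (nat \<Rightarrow> real) set \<Rightarrow> bool" where
  "alt_generators n U \<longleftrightarrow> finite U \<and> (\<forall>u\<in>U. \<exists>i\<in>{1..n}. u i \<noteq> 0) \<and>
     (\<forall>a. \<exists>t. (\<forall>u\<in>U. 0 \<le> t u) \<and> (\<forall>c\<in>alt_functionals n.
        c a = (\<Sum>u\<in>U. t u * c u) \<and> \<bar>c a\<bar> = (\<Sum>u\<in>U. t u * \<bar>c u\<bar>)))"

text \<open>Base of the elimination: the unit vectors with both signs, as coefficients must be
  nonnegative.\<close>

lemma coordinate_conic_generators:
  "\<exists>U :: (nat \<Rightarrow> real) set. finite U \<and>
     (\<forall>a. (\<forall>i. i \<notin> {1..n} \<longrightarrow> a i = 0) \<longrightarrow> conic_rep U {} a (\<lambda>_. 0))"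
proof -
  define e :: "nat \<Rightarrow> real \<Rightarrow> nat \<Rightarrow> real" where "e i r = (\<lambda>k. if k = i then r else 0)" for i r
  define U where "U = (\<lambda>(i, r). e i r) ` ({1..n} \<times> {1, -1})"
  have U: "finite U" by (simp add: U_def)
  have "conic_rep U {} a (\<lambda>_. 0)" if a: "\<forall>i. i \<notin> {1..n} \<longrightarrow> a i = 0" for a
  proof -
    let ?g = "\<lambda>i. \<bar>a i\<bar> *\<^sub>R e i (if 0 \<le> a i then 1 else -1)"
    have "conic_rep U {} (?g i) (\<lambda>c. \<bar>a i\<bar> * \<bar>c (e i (if 0 \<le> a i then 1 else -1))\<bar>)" if "i \<in> {1..n}" for i
      using U that by (intro conic_rep_generator) (auto simp: U_def)
    then have "conic_rep U {} (\<Sum>i\<in>{1..n}. ?g i)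
        (\<lambda>c. \<Sum>i\<in>{1..n}. \<bar>a i\<bar> * \<bar>c (e i (if 0 \<le> a i then 1 else -1))\<bar>)"
      by (rule conic_rep_sum)
    moreover have "(\<Sum>i\<in>{1..n}. ?g i) = a"
    proof
      fix k
      have "(\<Sum>i\<in>{1..n}. ?g i) k = (\<Sum>i\<in>{1..n}. if k = i then a k else 0)"
        unfolding sum_fun_apply by (intro sum.cong) (auto simp: scaleR_fun_def e_def)
      also have "\<dots> = a k" using a by (simp add: sum.delta)
      finally show "(\<Sum>i\<in>{1..n}. ?g i) k = a k" .
    qed
    ultimately show ?thesis by (simp add: conic_rep_def)
  qed
  with U show ?thesis by blast
qed

text \<open>Elimination applied to all alternating functionals on vectors supported in
  \<open>{1..n}\<close>. Its inequality becomes an equality by the triangle inequality. Generators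
  that vanish on \<open>{1..n}\<close> are invisible to the functionals and are discarded, so that
  the weights of the others can be bounded.\<close>

lemma alt_generators_exist: "\<exists>U. alt_generators n U"
proof -
  let ?C = "alt_functionals n"
  let ?V = "{a :: nat \<Rightarrow> real. \<forall>i. i \<notin> {1..n} \<longrightarrow> a i = 0}"
  obtain U0 :: "(nat \<Rightarrow> real) set" where "finite U0 \<and>
      (\<forall>a. (\<forall>i. i \<notin> {1..n} \<longrightarrow> a i = 0) \<longrightarrow> conic_rep U0 {} a (\<lambda>_. 0))"
    using coordinate_conic_generators ..
  then have U0: "finite U0" "\<And>a. a \<in> ?V \<Longrightarrow> conic_rep U0 {} a (\<lambda>_. 0)"
    by simp_all
  obtain U' where "finite U' \<and> (\<forall>a\<in>?V. conic_rep U' ?C a (\<lambda>c. \<bar>c a\<bar>))"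
    using finite_conic_generators[OF finite_alt_functionals linear_alt_functionals U0] ..
  then have U': "finite U'" "\<And>a. a \<in> ?V \<Longrightarrow> conic_rep U' ?C a (\<lambda>c. \<bar>c a\<bar>)"
    by simp_all
  define U where "U = {u\<in>U'. \<exists>i\<in>{1..n}. u i \<noteq> 0}"
  have neutral: "c u = 0" if "c \<in> ?C" "u \<in> U' - U" for c u
  proof -
    have "c u = c 0" using that by (intro alt_functionals_cong[OF that(1)]) (auto simp: U_def)
    then show ?thesis using linear_alt_functionals[OF that(1)] by (simp add: linear_0)
  qed
  have "\<exists>t. (\<forall>u\<in>U. 0 \<le> t u) \<and> (\<forall>c\<in>?C.
        c a = (\<Sum>u\<in>U. t u * c u) \<and> \<bar>c a\<bar> = (\<Sum>u\<in>U. t u * \<bar>c u\<bar>))" for a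
  proof -
    define a' where "a' = (\<lambda>i. if i \<in> {1..n} then a i else 0)"
    have "a' \<in> ?V" by (simp add: a'_def)
    from U'(2)[OF this] obtain t where t: "\<And>u. u \<in> U' \<Longrightarrow> 0 \<le> t u" "a' = (\<Sum>u\<in>U'. t u *\<^sub>R u)"
      "\<And>c. c \<in> ?C \<Longrightarrow> (\<Sum>u\<in>U'. t u * \<bar>c u\<bar>) \<le> \<bar>c a'\<bar>"
      unfolding conic_rep_def by blast
    have "c a = (\<Sum>u\<in>U. t u * c u) \<and> \<bar>c a\<bar> = (\<Sum>u\<in>U. t u * \<bar>c u\<bar>)" if c: "c \<in> ?C" for c
    proof -
      have aa: "c a = c a'" by (rule alt_functionals_cong[OF c]) (simp add: a'_def)
      have s1: "(\<Sum>u\<in>U'. t u * c u) = (\<Sum>u\<in>U. t u * c u)"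
        using U'(1) neutral[OF c] by (intro sum.mono_neutral_right) (auto simp: U_def)
      have s2: "(\<Sum>u\<in>U'. t u * \<bar>c u\<bar>) = (\<Sum>u\<in>U. t u * \<bar>c u\<bar>)"
        using U'(1) neutral[OF c] by (intro sum.mono_neutral_right) (auto simp: U_def)
      have e: "c a = (\<Sum>u\<in>U. t u * c u)"
        unfolding aa t(2) using linear_alt_functionals[OF c] s1 by (simp add: linear_sum linear_scale)
      have "\<bar>c a\<bar> \<le> (\<Sum>u\<in>U. \<bar>t u * c u\<bar>)" unfolding e by (rule sum_abs)
      also have "\<dots> = (\<Sum>u\<in>U. t u * \<bar>c u\<bar>)"
        using t(1) by (intro sum.cong) (auto simp: abs_mult U_def)
      finally show ?thesis using e t(3)[OF c] s2 aa by simp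
    qed
    then show ?thesis using t(1) by (intro exI[of _ t]) (auto simp: U_def)
  qed
  then have "alt_generators n U"
    unfolding alt_generators_def using U'(1) by (auto simp: U_def)
  then show ?thesis ..
qed

section \<open>The polytope of total weights and its stability\<close>

text \<open>Weights are functions on the whole type; fixing them to 0 outside \<open>U\<close> makes
  the set compact in the product topology.\<close>

definition weight_polytope :: "nat \<Rightarrow> (nat \<Rightarrow> real) set \<Rightarrow> ((nat \<Rightarrow> real) \<Rightarrow> real) set" where
  "weight_polytope n U = {t. (\<forall>u\<in>U. 0 \<le> t u) \<and> (\<forall>u. u \<notin> U \<longrightarrow> t u = 0) \<and>
     (\<forall>c\<in>alt_functionals n. (\<Sum>u\<in>U. t u * \<bar>c u\<bar>) \<le> 1)}"

lemma weight_polytope_le_1: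
  assumes "t \<in> weight_polytope n U" "c \<in> alt_functionals n"
  shows "(\<Sum>u\<in>U. t u * \<bar>c u\<bar>) \<le> 1"
proof -
  have "\<forall>c\<in>alt_functionals n. (\<Sum>u\<in>U. t u * \<bar>c u\<bar>) \<le> 1"
    using assms(1) by (simp add: weight_polytope_def)
  from bspec[OF this assms(2)] show ?thesis .
qed

lemmas weight_polytope_coordinate_le_1 =
  weight_polytope_le_1[OF _ coordinate_in_alt_functionals]

text \<open>Each generator has a nonzero coordinate \<open>u i\<close>, and the constraint for that
  coordinate functional gives \<open>t u \<le> 1 / \<bar>u i\<bar>\<close>. The polytope is thus a
  closed subset of a box.\<close>

lemma compact_weight_polytope:
  assumes "finite U" "\<forall>u\<in>U. \<exists>i\<in>{1..n}. u i \<noteq> 0"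
  shows "compact (weight_polytope n U)"
proof -
  obtain i where i: "\<And>u. u \<in> U \<Longrightarrow> i u \<in> {1..n} \<and> u (i u) \<noteq> 0" using assms(2) by metis
  define B where "B u = (if u \<in> U then 1 / \<bar>u (i u)\<bar> else 0)" for u
  let ?S = "\<lambda>c. {t :: (nat \<Rightarrow> real) \<Rightarrow> real. (\<Sum>u\<in>U. t u * \<bar>c u\<bar>) \<le> 1}"
  have le: "t u \<le> 1 / \<bar>u (i u)\<bar>" if t: "t \<in> weight_polytope n U" and u: "u \<in> U" for t u
  proof -
    have "t u * \<bar>u (i u)\<bar> \<le> (\<Sum>v\<in>U. t v * \<bar>v (i u)\<bar>)"
      using t assms(1) by (intro member_le_sum[OF u]) (simp_all add: weight_polytope_def)
    also have "\<dots> \<le> 1"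
      using t i[OF u] by (intro weight_polytope_coordinate_le_1) auto
    finally show ?thesis using i[OF u] by (simp add: field_simps)
  qed
  have "weight_polytope n U = {t. \<forall>u. 0 \<le> t u \<and> t u \<le> B u} \<inter> (\<Inter>c\<in>alt_functionals n. ?S c)"
  proof (intro equalityI subsetI)
    fix t assume t: "t \<in> weight_polytope n U"
    then have "0 \<le> t u \<and> t u \<le> B u" for u
      using le[OF t] by (cases "u \<in> U") (auto simp: weight_polytope_def B_def)
    with t show "t \<in> {t. \<forall>u. 0 \<le> t u \<and> t u \<le> B u} \<inter> (\<Inter>c\<in>alt_functionals n. ?S c)"
      by (simp add: weight_polytope_def)
  next
    fix t assume t: "t \<in> {t. \<forall>u. 0 \<le> t u \<and> t u \<le> B u} \<inter> (\<Inter>c\<in>alt_functionals n. ?S c)"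
    have "t u = 0" if "u \<notin> U" for u
    proof -
      have "0 \<le> t u \<and> t u \<le> B u" using t by blast
      then show ?thesis using that by (simp add: B_def)
    qed
    then show "t \<in> weight_polytope n U"
      using t by (simp add: weight_polytope_def)
  qed
  moreover have "closed (?S c)" for c :: "(nat \<Rightarrow> real) \<Rightarrow> real"
    by (intro closed_Collect_le continuous_intros
        continuous_on_subset[OF continuous_on_product_coordinates subset_UNIV])
  ultimately show ?thesis
    by (simp add: compact_Int_closed compact_box closed_INT)
qed

text \<open>Here \<open>g\<close> is the total defect over \<open>A\<close>. On the polytope each
  single defect is nonnegative, so \<open>g s \<le> 0\<close> forces every defect to vanish.\<close>

lemma weight_polytope_stable:
  assumes U: "finite U" "\<forall>u\<in>U. \<exists>i\<in>{1..n}. u i \<noteq> 0" and e: "0 < \<epsilon>"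
    and A: "A \<noteq> {}" "A \<subseteq> {1..n}"
  shows "\<exists>d>0. \<forall>t\<in>weight_polytope n U. (\<forall>i\<in>A. 1 - d < (\<Sum>u\<in>U. t u * u i)) \<longrightarrow>
    (\<exists>t'\<in>weight_polytope n U. (\<forall>i\<in>A. 1 \<le> (\<Sum>u\<in>U. t' u * u i)) \<and>
       (\<forall>i\<in>{1..n}. (\<Sum>u\<in>U. \<bar>t' u - t u\<bar> * \<bar>u i\<bar>) < \<epsilon>))"
proof -
  let ?K = "weight_polytope n U"
  define g where "g t = (\<Sum>i\<in>A. 1 - (\<Sum>u\<in>U. t u * u i))" for t :: "(nat \<Rightarrow> real) \<Rightarrow> real"
  define dst where "dst s t = (\<Sum>i\<in>{1..n}. \<Sum>u\<in>U. \<bar>s u - t u\<bar> * \<bar>u i\<bar>)"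
    for s t :: "(nat \<Rightarrow> real) \<Rightarrow> real"
  have finA: "finite A" using A(2) finite_subset by blast
  have coord: "continuous_on S (\<lambda>t :: (nat \<Rightarrow> real) \<Rightarrow> real. t u)" for S u
    by (rule continuous_on_subset[OF continuous_on_product_coordinates subset_UNIV])
  have cg: "continuous_on ?K g"
    unfolding g_def by (intro continuous_intros coord)
  have cd: "continuous_on UNIV (\<lambda>t. dst s t)" for s
    unfolding dst_def by (intro continuous_intros coord)
  have "dst t t = 0" for t by (simp add: dst_def)
  from compact_near_zero_set[OF compact_weight_polytope[OF U] cg cd this e]

  obtain d where d: "d > 0" "\<And>t. t \<in> ?K \<Longrightarrow> g t < d \<Longrightarrow> \<exists>s\<in>?K. g s \<le> 0 \<and> dst s t < \<epsilon>"
    by blast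
  have card: "card A > 0" using A(1) finA by (simp add: card_gt_0_iff)
  show ?thesis
  \<comment> \<open>A defect below \<open>d / card A\<close> for each of the \<open>card A\<close>
    indices keeps the total below \<open>d\<close>.\<close>
  proof (intro exI[of _ "d / card A"] conjI ballI impI)
    show "0 < d / card A" using d(1) card by simp
    fix t assume t: "t \<in> ?K" "\<forall>i\<in>A. 1 - d / card A < (\<Sum>u\<in>U. t u * u i)"
    have "g t < (\<Sum>i\<in>A. d / card A)"
      unfolding g_def using t(2) finA A(1) by (intro sum_strict_mono) (auto simp: algebra_simps)
    then have "g t < d" using card by simp
    from d(2)[OF t(1) this] obtain s where s: "s \<in> ?K" "g s \<le> 0" "dst s t < \<epsilon>" by blast
    have le1: "(\<Sum>u\<in>U. s u * u i) \<le> 1" if "i \<in> A" for i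
    proof -
      have "(\<Sum>u\<in>U. s u * u i) \<le> (\<Sum>u\<in>U. s u * \<bar>u i\<bar>)"
        using s(1) by (intro sum_mono mult_left_mono) (auto simp: weight_polytope_def)
      also have "\<dots> \<le> 1"
        using s(1) that A(2) by (intro weight_polytope_coordinate_le_1) auto
      finally show ?thesis .
    qed
    have nonneg: "\<forall>i\<in>A. 0 \<le> 1 - (\<Sum>u\<in>U. s u * u i)" using le1 by simp
    then have "0 \<le> g s" unfolding g_def by (intro sum_nonneg) simp
    then have "(\<Sum>i\<in>A. 1 - (\<Sum>u\<in>U. s u * u i)) = 0" using s(2) unfolding g_def by simp
    then have "\<forall>i\<in>A. 1 - (\<Sum>u\<in>U. s u * u i) = 0"
      by (subst (asm) sum_nonneg_eq_0_iff[OF finA]) (use nonneg in simp_all)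
    moreover have "(\<Sum>u\<in>U. \<bar>s u - t u\<bar> * \<bar>u i\<bar>) < \<epsilon>" if "i \<in> {1..n}" for i
    proof -
      have "(\<Sum>u\<in>U. \<bar>s u - t u\<bar> * \<bar>u i\<bar>) \<le> dst s t"
        unfolding dst_def using that
        by (intro member_le_sum[of i "{1..n}" "\<lambda>i. \<Sum>u\<in>U. \<bar>s u - t u\<bar> * \<bar>u i\<bar>"] sum_nonneg) auto
      then show ?thesis using s(3) by simp
    qed
    ultimately show "\<exists>t'\<in>?K. (\<forall>i\<in>A. 1 \<le> (\<Sum>u\<in>U. t' u * u i)) \<and>
       (\<forall>i\<in>{1..n}. (\<Sum>u\<in>U. \<bar>t' u - t u\<bar> * \<bar>u i\<bar>) < \<epsilon>)"
      using s(1) by (intro bexI[of _ s]) auto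
  qed
qed

definition stable_weights :: "nat \<Rightarrow> (nat \<Rightarrow> real) set \<Rightarrow> real \<Rightarrow> real \<Rightarrow> bool" where
  "stable_weights n U \<epsilon> d \<longleftrightarrow> (\<forall>A t. A \<noteq> {} \<and> A \<subseteq> {1..n} \<and> t \<in> weight_polytope n U \<and>
     (\<forall>i\<in>A. 1 - d < (\<Sum>u\<in>U. t u * u i)) \<longrightarrow>
     (\<exists>t'\<in>weight_polytope n U. (\<forall>i\<in>A. 1 \<le> (\<Sum>u\<in>U. t' u * u i)) \<and>
       (\<forall>i\<in>{1..n}. (\<Sum>u\<in>U. \<bar>t' u - t u\<bar> * \<bar>u i\<bar>) < \<epsilon>)))"

lemma stable_weights_exist:
  assumes U: "finite U" "\<forall>u\<in>U. \<exists>i\<in>{1..n}. u i \<noteq> 0" and e: "0 < \<epsilon>"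
  shows "\<exists>d>0. stable_weights n U \<epsilon> d"
proof -
  let ?P = "{A. A \<noteq> {} \<and> A \<subseteq> {1..n}}"
  have fin: "finite ?P" by (rule finite_subset[of _ "Pow {1..n}"]) auto
  define R where "R A t \<longleftrightarrow> (\<exists>t'\<in>weight_polytope n U. (\<forall>i\<in>A. 1 \<le> (\<Sum>u\<in>U. t' u * u i)) \<and>
       (\<forall>i\<in>{1..n}. (\<Sum>u\<in>U. \<bar>t' u - t u\<bar> * \<bar>u i\<bar>) < \<epsilon>))" for A t
  have "\<forall>A\<in>?P. \<exists>d>0. \<forall>t\<in>weight_polytope n U. (\<forall>i\<in>A. 1 - d < (\<Sum>u\<in>U. t u * u i)) \<longrightarrow> R A t"
    unfolding R_def using weight_polytope_stable[OF U e] by blast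
  then obtain d where d: "\<forall>A\<in>?P. d A > 0 \<and>
      (\<forall>t\<in>weight_polytope n U. (\<forall>i\<in>A. 1 - d A < (\<Sum>u\<in>U. t u * u i)) \<longrightarrow> R A t)"
    by (rule bchoice[THEN exE])
  \<comment> \<open>The minimum makes the bound uniform in \<open>A\<close>; inserting 1 keeps the
    set nonempty when \<open>n = 0\<close>.\<close>
  define m where "m = Min (insert 1 (d ` ?P))"
  have "m > 0" unfolding m_def using fin d by (subst Min_gr_iff) auto
  moreover have "R A t" if A: "A \<noteq> {} \<and> A \<subseteq> {1..n} \<and> t \<in> weight_polytope n U \<and>
     (\<forall>i\<in>A. 1 - m < (\<Sum>u\<in>U. t u * u i))" for A t
  proof -
    have "m \<le> d A" unfolding m_def using fin A by (intro Min_le) auto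
    then have "\<forall>i\<in>A. 1 - d A < (\<Sum>u\<in>U. t u * u i)" using A by force
    then show ?thesis using d A by blast
  qed
  ultimately show ?thesis
    unfolding stable_weights_def R_def by blast
qed

lemma stable_weights_mono:
  assumes "stable_weights n U \<epsilon> d" "d' \<le> d"
  shows "stable_weights n U \<epsilon> d'"
  unfolding stable_weights_def
proof (intro allI impI)
  fix A t
  assume *: "A \<noteq> {} \<and> A \<subseteq> {1..n} \<and> t \<in> weight_polytope n U \<and>
    (\<forall>i\<in>A. 1 - d' < (\<Sum>u\<in>U. t u * u i))"
  have "1 - d < (\<Sum>u\<in>U. t u * u i)" if "i \<in> A" for i
  proof -
    have "1 - d' < (\<Sum>u\<in>U. t u * u i)" using * that by blast
    then show ?thesis using assms(2) by linarith
  qed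
  with * have "A \<noteq> {} \<and> A \<subseteq> {1..n} \<and> t \<in> weight_polytope n U \<and>
    (\<forall>i\<in>A. 1 - d < (\<Sum>u\<in>U. t u * u i))" by blast
  from assms(1)[unfolded stable_weights_def, THEN spec, THEN spec, THEN mp, OF this]
  show "\<exists>t'\<in>weight_polytope n U. (\<forall>i\<in>A. 1 \<le> (\<Sum>u\<in>U. t' u * u i)) \<and>
       (\<forall>i\<in>{1..n}. (\<Sum>u\<in>U. \<bar>t' u - t u\<bar> * \<bar>u i\<bar>) < \<epsilon>)" .
qed

section \<open>Lifting a perturbation of the weights\<close>

text \<open>Multiplication by \<open>r / s\<close>, with \<open>s\<close> the mass of
  \<open>\<tau>\<close>, moves all entries in the same direction, so the total change is
  \<open>\<bar>r - s\<bar>\<close>. A zero sequence cannot be rescaled; the mass \<open>r\<close> is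
  then put at coordinate 0, which is why \<open>0 \<in> J\<close> is assumed.\<close>

lemma rescale_weights:
  fixes \<tau> :: "nat \<Rightarrow> real"
  assumes \<tau>: "\<And>j. 0 \<le> \<tau> j" "summable \<tau>" and r: "0 \<le> r"
    and J: "0 \<in> J" "\<And>j. j \<notin> J \<Longrightarrow> \<tau> j = 0"
  shows "\<exists>\<sigma>. (\<forall>j. 0 \<le> \<sigma> j) \<and> (\<forall>j. j \<notin> J \<longrightarrow> \<sigma> j = 0) \<and> \<sigma> sums r \<and>
    (\<lambda>j. \<bar>\<sigma> j - \<tau> j\<bar>) sums \<bar>r - (\<Sum>j. \<tau> j)\<bar>"
proof (cases "(\<Sum>j. \<tau> j) = 0")
  case True
  then have "\<tau> j = 0" for j using \<tau> by (simp add: suminf_eq_zero_iff)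
  moreover have "(\<lambda>j. if j = 0 then r else 0) sums r" by (rule sums_single)
  ultimately show ?thesis
    using J r True by (intro exI[of _ "\<lambda>j. if j = 0 then r else 0"]) (auto simp: if_distrib[of abs] cong: if_cong)
next
  case False
  define s where "s = (\<Sum>j. \<tau> j)"
  have s: "s > 0" "\<tau> sums s"
    using False suminf_nonneg[OF \<tau>(2,1)] \<tau>(2) by (auto simp: s_def)
  have "(\<lambda>j. r / s * \<tau> j) sums (r / s * s)" using s(2) by (rule sums_mult)
  moreover have "(\<lambda>j. \<bar>r / s - 1\<bar> * \<tau> j) sums (\<bar>r / s - 1\<bar> * s)" using s(2) by (rule sums_mult)
  moreover have "\<bar>r / s - 1\<bar> * s = \<bar>r - s\<bar>"
    using s(1) abs_mult_pos[of s "r / s - 1"] by (simp add: left_diff_distrib)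
  moreover have "\<bar>r / s - 1\<bar> * \<tau> j = \<bar>r / s * \<tau> j - \<tau> j\<bar>" for j
    using abs_mult_pos[OF \<tau>(1)[of j], of "r / s - 1"] by (simp add: left_diff_distrib)
  ultimately show ?thesis
    unfolding s_def[symmetric] using J r s \<tau>(1)
    by (intro exI[of _ "\<lambda>j. r / s * \<tau> j"]) auto
qed

lemma sums_weighted:
  fixes f :: "nat \<Rightarrow> 'b \<Rightarrow> real"
  assumes "\<And>u. u \<in> U \<Longrightarrow> (\<lambda>j. f j u) sums g u"
  shows "(\<lambda>j. \<Sum>u\<in>U. f j u * h u) sums (\<Sum>u\<in>U. g u * h u)"
  by (intro sums_sum sums_mult2 assms)

lemma dominated_ell1:
  assumes "\<And>j. \<bar>x j\<bar> \<le> g j" "g sums b"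
  shows "x \<in> ell1" "ell1_norm x \<le> b"
proof -
  have s: "summable (\<lambda>j. \<bar>x j\<bar>)"
    by (rule summable_comparison_test'[of g 0]) (use assms in \<open>auto simp: sums_iff\<close>)
  then show "x \<in> ell1" by (simp add: ell1_def)
  have "ell1_norm x \<le> (\<Sum>j. g j)"
    unfolding ell1_norm_def by (intro suminf_le s) (use assms in \<open>auto simp: sums_iff\<close>)
  then show "ell1_norm x \<le> b" using assms(2) by (simp add: sums_iff)
qed

lemma perturb_M_set:
  fixes y :: "nat \<Rightarrow> nat \<Rightarrow> real" and s :: "nat \<Rightarrow> real"
  assumes gen: "alt_generators n U" and stab: "stable_weights n U \<epsilon> d"
    and V: "V = coord_space J" and J: "0 \<in> J" and N: "\<And>x. x \<in> V \<Longrightarrow> N x = ell1_norm x"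
    and y: "y \<in> M_set V N n" and A: "A \<noteq> {}" "A \<subseteq> {1..n}"
    and s: "\<And>j. \<bar>s j\<bar> = 1" and sy: "\<And>i. i \<in> A \<Longrightarrow> 1 - d < (\<Sum>j. s j * y i j)"
  shows "\<exists>z\<in>M_set V N n. (\<forall>i\<in>{1..n}. N (z i - y i) < \<epsilon>) \<and> N (\<Sum>i\<in>A. z i) = real (card A)"
proof -
  let ?C = "alt_functionals n"
  have lin: "linear c" if "c \<in> ?C" for c using that by (rule linear_alt_functionals)
  have ss: "s j * (s j * r) = r" for j r
  proof -
    have "s j * s j = 1" using s[of j] by (metis abs_mult_self_eq mult_1)
    then show ?thesis by (simp flip: mult.assoc)
  qed
  have yV: "y i \<in> V" if "i \<in> {1..n}" for i using y that by (auto simp: M_set_def)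
  have y_outside: "y i j = 0" if "i \<in> {1..n}" "j \<notin> J" for i j
    using yV[OF that(1)] that(2) by (simp add: V coord_space_def)
  have y_sm: "summable (\<lambda>j. \<bar>y i j\<bar>)" if "i \<in> {1..n}" for i
    using yV[OF that] by (simp add: V coord_space_def ell1_def)
  have coordC: "(\<lambda>a. a i) \<in> ?C" if "i \<in> {1..n}" for i
    using that by (rule coordinate_in_alt_functionals)
  have finU: "finite U" and nzU: "\<forall>u\<in>U. \<exists>i\<in>{1..n}. u i \<noteq> 0"
    using gen[unfolded alt_generators_def] by (rule conjunct1, rule conjunct2[THEN conjunct1])
  \<comment> \<open>The columns are expanded after multiplication by their signs, so that the signed
    sum of \<open>y i\<close> becomes a plain sum of coordinates.\<close>
  have "\<forall>j. \<exists>t. (\<forall>u\<in>U. 0 \<le> t u) \<and> (\<forall>c\<in>?C. c (\<lambda>i. s j * y i j) = (\<Sum>u\<in>U. t u * c u) \<and>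
      \<bar>c (\<lambda>i. s j * y i j)\<bar> = (\<Sum>u\<in>U. t u * \<bar>c u\<bar>))"
    by (intro allI gen[unfolded alt_generators_def, THEN conjunct2, THEN conjunct2, rule_format])
  then obtain \<tau> where H: "\<forall>j. (\<forall>u\<in>U. 0 \<le> \<tau> j u) \<and> (\<forall>c\<in>?C. c (\<lambda>i. s j * y i j) = (\<Sum>u\<in>U. \<tau> j u * c u) \<and>
      \<bar>c (\<lambda>i. s j * y i j)\<bar> = (\<Sum>u\<in>U. \<tau> j u * \<bar>c u\<bar>))"
    by (rule choice[THEN exE])
  have \<tau>0: "0 \<le> \<tau> j u" if "u \<in> U" for j u
    using H that by blast
  have \<tau>c: "c (\<lambda>i. s j * y i j) = (\<Sum>u\<in>U. \<tau> j u * c u)"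
    and \<tau>abs': "\<bar>c (\<lambda>i. s j * y i j)\<bar> = (\<Sum>u\<in>U. \<tau> j u * \<bar>c u\<bar>)" if "c \<in> ?C" for j c
    using H[THEN spec, of j, THEN conjunct2, THEN bspec, OF that] by (rule conjunct1, rule conjunct2)
  have scale: "c (\<lambda>i. s j * a i) = s j * c a" if "c \<in> ?C" for c j a
    using linear_scale[OF lin[OF that], of "s j" a] by (simp add: scaleR_fun_def)
  have \<tau>abs: "\<bar>c (\<lambda>i. y i j)\<bar> = (\<Sum>u\<in>U. \<tau> j u * \<bar>c u\<bar>)" if "c \<in> ?C" for c j
    using \<tau>abs'[OF that, of j] scale[OF that, of j "\<lambda>i. y i j"] s[of j] by (simp add: abs_mult)
  have \<tau>le: "\<tau> j u * \<bar>u i\<bar> \<le> \<bar>y i j\<bar>" if u: "u \<in> U" and i: "i \<in> {1..n}" for j u i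
  proof -
    have "\<tau> j u * \<bar>u i\<bar> \<le> (\<Sum>u\<in>U. \<tau> j u * \<bar>u i\<bar>)"
      using finU \<tau>0 by (intro member_le_sum[OF u]) simp_all
    then show ?thesis using \<tau>abs[OF coordC[OF i], of j] by simp
  qed
  \<comment> \<open>A nonzero coordinate \<open>u i\<close> dominates the weights of
    \<open>u\<close> by a multiple of \<open>\<bar>y i j\<bar>\<close>; this gives both summability
    and support in \<open>J\<close>.\<close>
  have \<tau>: "summable (\<lambda>j. \<tau> j u)" "\<And>j. j \<notin> J \<Longrightarrow> \<tau> j u = 0" if u: "u \<in> U" for u
  proof -
    obtain i where i: "i \<in> {1..n}" "u i \<noteq> 0" using nzU u by blast
    have le: "\<tau> j u \<le> \<bar>y i j\<bar> / \<bar>u i\<bar>" for j using \<tau>le[OF u i(1), of j] i(2) by (simp add: field_simps)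
    show "summable (\<lambda>j. \<tau> j u)"
      by (rule summable_comparison_test'[of "\<lambda>j. \<bar>y i j\<bar> / \<bar>u i\<bar>" 0])
        (use le \<tau>0[OF u] y_sm[OF i(1)] in \<open>auto intro: summable_divide\<close>)
    show "\<tau> j u = 0" if "j \<notin> J" for j
      using le[of j] \<tau>0[OF u, of j] y_outside[OF i(1) that] by simp
  qed
  define t where "t u = (if u \<in> U then \<Sum>j. \<tau> j u else 0)" for u
  have \<tau>sums: "(\<lambda>j. \<tau> j u) sums t u" if "u \<in> U" for u
    using \<tau>(1)[OF that] that by (simp add: t_def summable_sums)
  \<comment> \<open>Exact additivity of absolute values enters here: the total for \<open>c\<close>
    is the norm of the corresponding alternating sum of \<open>y\<close>, hence at most 1.\<close>
  have "t \<in> weight_polytope n U"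
    unfolding weight_polytope_def
  proof (intro CollectI conjI ballI allI impI)
    show "0 \<le> t u" if "u \<in> U" for u
      using \<tau>(1)[OF that] \<tau>0[OF that] that by (simp add: t_def suminf_nonneg)
    show "t u = 0" if "u \<notin> U" for u using that by (simp add: t_def)
    fix c assume c: "c \<in> ?C"
    let ?x = "\<lambda>j. c (\<lambda>i. y i j)"
    have sums: "(\<lambda>j. \<bar>?x j\<bar>) sums (\<Sum>u\<in>U. t u * \<bar>c u\<bar>)"
      unfolding \<tau>abs[OF c] by (rule sums_weighted[OF \<tau>sums])
    have "?x j = 0" if "j \<notin> J" for j
    proof -
      have "?x j = c 0" using y_outside[OF _ that] by (intro alt_functionals_cong[OF c]) auto
      then show ?thesis using lin[OF c] by (simp add: linear_0)
    qed
    then have xV: "?x \<in> V" using sums by (simp add: V coord_space_def ell1_def sums_iff)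
    have "N ?x \<le> 1" using y[unfolded M_set_iff, THEN conjunct2, THEN bspec, OF c] .
    then show "(\<Sum>u\<in>U. t u * \<bar>c u\<bar>) \<le> 1"
      using N[OF xV] sums by (simp add: ell1_norm_def sums_iff)
  qed
  moreover have "1 - d < (\<Sum>u\<in>U. t u * u i)" if i: "i \<in> A" for i
  proof -
    have "s j * y i j = (\<Sum>u\<in>U. \<tau> j u * u i)" for j
      using \<tau>c[OF coordC, of i j] i A(2) by auto
    then have "(\<lambda>j. s j * y i j) sums (\<Sum>u\<in>U. t u * u i)"
      using sums_weighted[OF \<tau>sums, of U "\<lambda>u. u" "\<lambda>u. u i"] by simp
    then show ?thesis using sy[OF i] by (simp add: sums_iff)
  qed
  ultimately have "A \<noteq> {} \<and> A \<subseteq> {1..n} \<and> t \<in> weight_polytope n U \<and>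
      (\<forall>i\<in>A. 1 - d < (\<Sum>u\<in>U. t u * u i))"
    using A by simp
  from stab[unfolded stable_weights_def, THEN spec, THEN spec, THEN mp, OF this]
  obtain t' where "t' \<in> weight_polytope n U" "(\<forall>i\<in>A. 1 \<le> (\<Sum>u\<in>U. t' u * u i)) \<and>
      (\<forall>i\<in>{1..n}. (\<Sum>u\<in>U. \<bar>t' u - t u\<bar> * \<bar>u i\<bar>) < \<epsilon>)"
    by (rule bexE)
  then have t': "t' \<in> weight_polytope n U"
    "\<And>i. i \<in> A \<Longrightarrow> 1 \<le> (\<Sum>u\<in>U. t' u * u i)"
    "\<And>i. i \<in> {1..n} \<Longrightarrow> (\<Sum>u\<in>U. \<bar>t' u - t u\<bar> * \<bar>u i\<bar>) < \<epsilon>"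
    by simp_all
  have "\<forall>u\<in>U. \<exists>\<sigma>. (\<forall>j. 0 \<le> \<sigma> j) \<and> (\<forall>j. j \<notin> J \<longrightarrow> \<sigma> j = 0) \<and> \<sigma> sums t' u \<and>
    (\<lambda>j. \<bar>\<sigma> j - \<tau> j u\<bar>) sums \<bar>t' u - t u\<bar>"
  proof
    fix u assume u: "u \<in> U"
    have "t u = (\<Sum>j. \<tau> j u)" using u by (simp add: t_def)
    moreover have "0 \<le> t' u" using t'(1) u by (simp add: weight_polytope_def)
    ultimately show "\<exists>\<sigma>. (\<forall>j. 0 \<le> \<sigma> j) \<and> (\<forall>j. j \<notin> J \<longrightarrow> \<sigma> j = 0) \<and> \<sigma> sums t' u \<and>
        (\<lambda>j. \<bar>\<sigma> j - \<tau> j u\<bar>) sums \<bar>t' u - t u\<bar>"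
      using rescale_weights[of "\<lambda>j. \<tau> j u" "t' u" J] \<tau>0[OF u] \<tau>[OF u] J by simp
  qed
  then obtain \<sigma> where "\<forall>u\<in>U. (\<forall>j. 0 \<le> \<sigma> u j) \<and> (\<forall>j. j \<notin> J \<longrightarrow> \<sigma> u j = 0) \<and> \<sigma> u sums t' u \<and>
    (\<lambda>j. \<bar>\<sigma> u j - \<tau> j u\<bar>) sums \<bar>t' u - t u\<bar>"
    by (rule bchoice[THEN exE])
  then have \<sigma>0: "\<And>u j. u \<in> U \<Longrightarrow> 0 \<le> \<sigma> u j"
    and \<sigma>J: "\<And>u j. u \<in> U \<Longrightarrow> j \<notin> J \<Longrightarrow> \<sigma> u j = 0"
    and \<sigma>sums: "\<And>u. u \<in> U \<Longrightarrow> (\<lambda>j. \<sigma> u j) sums t' u"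
    and \<sigma>dist: "\<And>u. u \<in> U \<Longrightarrow> (\<lambda>j. \<bar>\<sigma> u j - \<tau> j u\<bar>) sums \<bar>t' u - t u\<bar>"
    by blast+
  \<comment> \<open>The factor \<open>s j\<close> undoes the change of signs, and the restriction to
    \<open>{1..n}\<close> makes \<open>z\<close> extensional, as \<open>M_set\<close>
    demands.\<close>
  define z where "z = (\<lambda>i\<in>{1..n}. \<lambda>j. s j * (\<Sum>u\<in>U. \<sigma> u j * u i))"
  have zi: "z i j = s j * (\<Sum>u\<in>U. \<sigma> u j * u i)" if "i \<in> {1..n}" for i j
    using that by (simp add: z_def)
  have zc: "c (\<lambda>i. z i j) = s j * (\<Sum>u\<in>U. \<sigma> u j * c u)" if c: "c \<in> ?C" for c j
  proof -
    have "c (\<lambda>i. z i j) = c (\<lambda>i. s j * (\<Sum>u\<in>U. \<sigma> u j *\<^sub>R u) i)"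
      using zi by (intro alt_functionals_cong[OF c]) (simp add: sum_fun_apply scaleR_fun_def)
    also have "\<dots> = s j * c (\<Sum>u\<in>U. \<sigma> u j *\<^sub>R u)" by (rule scale[OF c])
    also have "\<dots> = s j * (\<Sum>u\<in>U. \<sigma> u j * c u)"
      using lin[OF c] by (simp add: linear_sum linear_scale)
    finally show ?thesis .
  qed
  have zcV: "(\<lambda>j. c (\<lambda>i. z i j)) \<in> V" and zc1: "ell1_norm (\<lambda>j. c (\<lambda>i. z i j)) \<le> 1" if c: "c \<in> ?C" for c
  proof -
    have bound: "\<bar>c (\<lambda>i. z i j)\<bar> \<le> (\<Sum>u\<in>U. \<sigma> u j * \<bar>c u\<bar>)" for j
    proof -
      have "\<bar>c (\<lambda>i. z i j)\<bar> = \<bar>\<Sum>u\<in>U. \<sigma> u j * c u\<bar>" by (simp add: zc[OF c] abs_mult s)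
      also have "\<dots> \<le> (\<Sum>u\<in>U. \<bar>\<sigma> u j * c u\<bar>)" by (rule sum_abs)
      also have "\<dots> = (\<Sum>u\<in>U. \<sigma> u j * \<bar>c u\<bar>)" using \<sigma>0 by (simp add: abs_mult)
      finally show ?thesis .
    qed
    have sums: "(\<lambda>j. \<Sum>u\<in>U. \<sigma> u j * \<bar>c u\<bar>) sums (\<Sum>u\<in>U. t' u * \<bar>c u\<bar>)"
      by (rule sums_weighted[OF \<sigma>sums])
    have "c (\<lambda>i. z i j) = 0" if "j \<notin> J" for j
      using \<sigma>J that by (simp add: zc[OF c])
    then show "(\<lambda>j. c (\<lambda>i. z i j)) \<in> V"
      using dominated_ell1(1)[OF bound sums] by (simp add: V coord_space_def)
    have "(\<Sum>u\<in>U. t' u * \<bar>c u\<bar>) \<le> 1" using t'(1) c by (rule weight_polytope_le_1)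
    then show "ell1_norm (\<lambda>j. c (\<lambda>i. z i j)) \<le> 1"
      using dominated_ell1(2)[OF bound sums] by simp
  qed
  have zV: "z i \<in> V" and z1: "ell1_norm (z i) \<le> 1" if "i \<in> {1..n}" for i
    using zcV[OF coordC[OF that]] zc1[OF coordC[OF that]] by simp_all
  have zM: "z \<in> M_set V N n"
    unfolding M_set_iff
  proof (intro conjI ballI)
    show "z \<in> {1..n} \<rightarrow>\<^sub>E V" using zV by (auto simp: z_def)
    show "N (\<lambda>j. c (\<lambda>i. z i j)) \<le> 1" if "c \<in> ?C" for c
      using zc1[OF that] N[OF zcV[OF that]] by simp
  qed
  have subV: "x \<in> V" if "x \<in> ell1" "\<And>j. j \<notin> J \<Longrightarrow> x j = 0" for x
    using that by (simp add: V coord_space_def)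
  \<comment> \<open>Both tuples are expanded in the same generators, so their distance is controlled
    by the weights alone, through \<open>\<sigma>dist\<close>.\<close>
  have close: "N (z i - y i) < \<epsilon>" if i: "i \<in> {1..n}" for i
  proof -
    have bound: "\<bar>(z i - y i) j\<bar> \<le> (\<Sum>u\<in>U. \<bar>\<sigma> u j - \<tau> j u\<bar> * \<bar>u i\<bar>)" for j
    proof -
      have "y i j = s j * (\<Sum>u\<in>U. \<tau> j u * u i)"
        using \<tau>c[OF coordC[OF i], of j] ss[of j "y i j"] by simp
      then have "(z i - y i) j = s j * (\<Sum>u\<in>U. (\<sigma> u j - \<tau> j u) * u i)"
        by (simp add: zi[OF i] sum_subtractf left_diff_distrib right_diff_distrib)
      then have "\<bar>(z i - y i) j\<bar> = \<bar>\<Sum>u\<in>U. (\<sigma> u j - \<tau> j u) * u i\<bar>" by (simp add: abs_mult s)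
      also have "\<dots> \<le> (\<Sum>u\<in>U. \<bar>\<sigma> u j - \<tau> j u\<bar> * \<bar>u i\<bar>)"
        unfolding abs_mult[symmetric] by (rule sum_abs)
      finally show ?thesis .
    qed
    have sums: "(\<lambda>j. \<Sum>u\<in>U. \<bar>\<sigma> u j - \<tau> j u\<bar> * \<bar>u i\<bar>) sums (\<Sum>u\<in>U. \<bar>t' u - t u\<bar> * \<bar>u i\<bar>)"
      by (rule sums_weighted[OF \<sigma>dist])
    have zy: "z i - y i \<in> ell1" "ell1_norm (z i - y i) \<le> (\<Sum>u\<in>U. \<bar>t' u - t u\<bar> * \<bar>u i\<bar>)"
      by (rule dominated_ell1[OF bound sums])+
    have "z i j = 0" if "j \<notin> J" for j
      using zV[OF i] that by (simp add: V coord_space_def)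
    then have "z i - y i \<in> V"
      using zy(1) y_outside[OF i] by (intro subV) simp_all
    then show ?thesis using N zy(2) t'(3)[OF i] by fastforce
  qed
  have Ain: "i \<in> {1..n}" if "i \<in> A" for i using that A(2) by blast
  have abs_sums: "(\<lambda>j. \<bar>z i j\<bar>) sums ell1_norm (z i)" if "i \<in> A" for i
    using zV[OF Ain[OF that]] by (simp add: V coord_space_def ell1_def ell1_norm_def summable_sums)
  have up: "(\<lambda>j. \<Sum>i\<in>A. \<bar>z i j\<bar>) sums (\<Sum>i\<in>A. ell1_norm (z i))"
    by (intro sums_sum abs_sums)
  have bound: "\<bar>(\<Sum>i\<in>A. z i) j\<bar> \<le> (\<Sum>i\<in>A. \<bar>z i j\<bar>)" for j
    unfolding sum_fun_apply by (rule sum_abs)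
  have sum: "(\<Sum>i\<in>A. z i) \<in> ell1" "ell1_norm (\<Sum>i\<in>A. z i) \<le> (\<Sum>i\<in>A. ell1_norm (z i))"
    by (rule dominated_ell1[OF bound up])+
  have "z i j = 0" if "i \<in> A" "j \<notin> J" for i j
    using zV[OF Ain[OF that(1)]] that(2) by (simp add: V coord_space_def)
  then have sumV: "(\<Sum>i\<in>A. z i) \<in> V"
    using sum(1) by (intro subV) (simp_all add: sum_fun_apply)
  have "(\<Sum>i\<in>A. ell1_norm (z i)) \<le> (\<Sum>i\<in>A. 1)" using z1[OF Ain] by (intro sum_mono)
  then have le: "N (\<Sum>i\<in>A. z i) \<le> card A"
    using sum(2) N[OF sumV] by simp
  \<comment> \<open>The signs \<open>s j\<close> test the sum from below: the signed coordinates add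
    up to the sum over \<open>A\<close> of the numbers \<open>\<Sum>u\<in>U. t' u * u i\<close>,
    each at least 1. The upper bound \<open>le\<close> comes from the norms of the single
    \<open>z i\<close>.\<close>
  have low: "(\<lambda>j. \<Sum>i\<in>A. \<Sum>u\<in>U. \<sigma> u j * u i) sums (\<Sum>i\<in>A. \<Sum>u\<in>U. t' u * u i)"
    by (intro sums_sum sums_weighted[OF \<sigma>sums])
  have low_le: "(\<Sum>i\<in>A. \<Sum>u\<in>U. \<sigma> u j * u i) \<le> \<bar>(\<Sum>i\<in>A. z i) j\<bar>" for j
  proof -
    have "(\<Sum>i\<in>A. z i) j = s j * (\<Sum>i\<in>A. \<Sum>u\<in>U. \<sigma> u j * u i)"
      unfolding sum_fun_apply sum_distrib_left[of "s j"] by (intro sum.cong refl) (simp add: zi[OF Ain] sum_distrib_left)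
    then show ?thesis by (simp add: abs_mult s)
  qed
  have "(\<lambda>j. \<bar>(\<Sum>i\<in>A. z i) j\<bar>) sums N (\<Sum>i\<in>A. z i)"
    using sumV N[OF sumV] by (simp add: V coord_space_def ell1_def ell1_norm_def summable_sums)
  with low_le low have "(\<Sum>i\<in>A. \<Sum>u\<in>U. t' u * u i) \<le> N (\<Sum>i\<in>A. z i)"
    by (rule sums_le)
  moreover have "(\<Sum>i\<in>A. 1) \<le> (\<Sum>i\<in>A. \<Sum>u\<in>U. t' u * u i)" using t'(2) by (intro sum_mono)
  ultimately have "N (\<Sum>i\<in>A. z i) = card A" using le by simp
  with zM close show ?thesis by blast
qed

section \<open>Assembly with one function for all the spaces\<close>

lemma AHSp_linf_with_coord_space:
  assumes gen: "alt_generators n U"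
    and \<gamma>: "\<And>\<epsilon>. 0 < \<epsilon> \<Longrightarrow> \<epsilon> < 1 \<Longrightarrow> 0 < \<gamma> \<epsilon> \<and> \<gamma> \<epsilon> < \<epsilon> \<and> stable_weights n U \<epsilon> (2 * \<gamma> \<epsilon>)"
    and V: "V = coord_space J" and J: "0 \<in> J" and N: "\<And>x. x \<in> V \<Longrightarrow> N x = ell1_norm x"
    and ban: "banach_on V N"
  shows "AHSp_linf_with V N n \<gamma>"
proof -
  have "\<exists>z\<in>M_set V N n. (\<forall>i\<in>{1..n}. N (z i - y i) < \<epsilon>) \<and> N (\<Sum>i\<in>A. z i) = real (card A)"
    if \<epsilon>: "0 < \<epsilon>" "\<epsilon> < 1" and y: "y \<in> M_set V N n" and A: "A \<noteq> {}" "A \<subseteq> {1..n}"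
      and f: "f \<in> dual_sphere V N" and fy: "\<forall>i\<in>A. f (y i) > 1 - \<gamma> \<epsilon>" for \<epsilon> y A f
  proof -
    have nrm: "norm_on V N" using ban by (simp add: banach_on_def)
    obtain s :: "nat \<Rightarrow> real" where s: "\<forall>j. \<bar>s j\<bar> = 1"
      "\<forall>x\<in>V. N x \<le> 1 \<longrightarrow> 2 * f x - 1 \<le> (\<Sum>j. s j * x j)"
      using dual_sphere_signs[OF V N nrm f] by blast
    \<comment> \<open>Passing to signs doubles the defect, so stability is required for
      \<open>2 * \<gamma> \<epsilon>\<close>.\<close>
    have "1 - 2 * \<gamma> \<epsilon> < (\<Sum>j. s j * y i j)" if "i \<in> A" for i
    proof -
      have i: "i \<in> {1..n}" using that A(2) by blast
      have "y i \<in> V" "N (y i) \<le> 1"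
        using M_set_coordinate[OF y i] by simp_all
      then have "2 * f (y i) - 1 \<le> (\<Sum>j. s j * y i j)" using s(2) by blast
      then show ?thesis using fy that by force
    qed
    moreover have "stable_weights n U \<epsilon> (2 * \<gamma> \<epsilon>)" using \<gamma> \<epsilon> by blast
    ultimately show ?thesis
      using perturb_M_set[OF gen _ V J N y A] s(1) by blast
  qed
  then show ?thesis
    unfolding AHSp_linf_with_def using ban \<gamma> by blast
qed

theorem corollary4p3:
  shows "(\<forall>n\<ge>1. AHSp_linf ell1 ell1_norm n) \<and>
    (\<forall>n\<ge>1. \<exists>\<gamma> :: real \<Rightarrow> real.
       AHSp_linf_with ell1 ell1_norm n \<gamma> \<and>
       (\<forall>m\<ge>1. AHSp_linf_with (ell1_fin m) (ell1_fin_norm m) n \<gamma>))"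
proof -
  have "\<exists>\<gamma>. AHSp_linf_with ell1 ell1_norm n \<gamma> \<and>
       (\<forall>m\<ge>1. AHSp_linf_with (ell1_fin m) (ell1_fin_norm m) n \<gamma>)" for n
  proof -
    obtain U where gen: "alt_generators n U" using alt_generators_exist ..
    then have U: "finite U" "\<forall>u\<in>U. \<exists>i\<in>{1..n}. u i \<noteq> 0"
      unfolding alt_generators_def by (rule conjunct1, rule conjunct2[THEN conjunct1])
    \<comment> \<open>\<open>U\<close> and \<open>d\<close> depend only on \<open>n\<close> and
      \<open>\<epsilon>\<close>, so no space enters the choice of \<open>\<gamma>\<close>. In the
      witness, \<open>\<epsilon> / 2\<close> ensures \<open>g < \<epsilon>\<close> and
      \<open>d / 2\<close> ensures \<open>2 * g \<le> d\<close>.\<close>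
    have "\<exists>g. 0 < g \<and> g < \<epsilon> \<and> stable_weights n U \<epsilon> (2 * g)" if "0 < \<epsilon>" for \<epsilon>
    proof -
      obtain d where d: "d > 0" "stable_weights n U \<epsilon> d"
        using stable_weights_exist[OF U \<open>0 < \<epsilon>\<close>] by blast
      have "2 * min (\<epsilon> / 2) (d / 2) \<le> d" by simp
      then have "stable_weights n U \<epsilon> (2 * min (\<epsilon> / 2) (d / 2))"
        using d(2) stable_weights_mono by blast
      then show ?thesis using that d(1) by (intro exI[of _ "min (\<epsilon> / 2) (d / 2)"]) auto
    qed
    then obtain \<gamma> where \<gamma>: "\<And>\<epsilon>. 0 < \<epsilon> \<Longrightarrow> 0 < \<gamma> \<epsilon> \<and> \<gamma> \<epsilon> < \<epsilon> \<and> stable_weights n U \<epsilon> (2 * \<gamma> \<epsilon>)"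
      by metis
    have "AHSp_linf_with ell1 ell1_norm n \<gamma>"
      using AHSp_linf_with_coord_space[OF gen \<gamma> ell1_eq_coord_space _ _ banach_on_ell1] by simp
    \<comment> \<open>The bound \<open>m \<ge> 1\<close> supplies the coordinate 0 in
      \<open>{..<m}\<close>.\<close>
    moreover have "AHSp_linf_with (ell1_fin m) (ell1_fin_norm m) n \<gamma>" if "m \<ge> 1" for m
      using that AHSp_linf_with_coord_space[OF gen \<gamma> ell1_fin_eq_coord_space _ _ banach_on_ell1_fin]
      by (simp add: ell1_fin_in_ell1(2))
    ultimately show ?thesis by blast
  qed
  then show ?thesis unfolding AHSp_linf_def by blast
qed

end
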